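(* A sequence $(\mathcal{X}_n)_{n\in\mathbb{N}}$ in $\mathbb{M}$ converges to $\mathcal{X}\in\mathbb{M}$ if and only if $\lim_{n\to\infty}\chi_A(\mathcal{X}_n)=\chi_A(\mathcal{X})$ for all $A\in\mathbb{A}$.
   Context: $\mathbb{N}=\{0,1,2,\ldots\}$, $\mathbb{R}_+=[0,\infty)$. A metric measure space is a triple $\mathcal{X}=(X,r_X,\mu_X)$ where $(X,r_X)$ is a complete separable metric space and $\mu_X$ is a Borel probability measure on $X$ with full support. Two such spaces are equivalent if there is an isometry from one onto the other that maps the first probability measure to the second by push-forward. $\mathbb{M}$ denotes the set of equivalence classes, and a class is not distinguished from its representatives. $\mathbb{M}$ carries the topology of the Gromov–Prohorov metric $d_{\mathrm{GPr}}(\mathcal{X},\mathcal{Y}):=\inf d_{\mathrm{Pr}}^{(Z,r_Z)}(\mu_X\circ\phi_X^{-1},\mu_Y\circ\phi_Y^{-1})$, where the infimum is over all metric spaces $(Z,r_Z)$ and isometric embeddings $\phi_X:X\to Z$, $\phi_Y:Y\to Z$, and $d_{\mathrm{Pr}}^{(Z,r_Z)}$ is the Prohorov metric on probability measures on $(Z,r_Z)$; convergence in $\mathbb{M}$ is with respect to $d_{\mathrm{GPr}}$. $\mathbb{A}$ is the set consisting of the empty set and the arrays $A=(a_{ij})_{1\le i<j\le n}\in\mathbb{R}_+^{\binom n2}$ for $n\ge2$. For $A\in\mathbb{A}$ the function $\chi_A:\mathbb{M}\to[0,1]$ is defined by $\chi_\emptyset\equiv1$ and, for $A=(a_{ij})_{1\le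 i<j\le n}$, $$\chi_A((X,r_X,\mu_X)):=\int_{X^n}\exp\Big(-\sum_{1\le i<j\le n}a_{ij}r_X(x_i,x_j)\Big)\,\mu_X^{\otimes n}(dx).$$ *)

theory Defs
  imports "HOL-Probability.Probability"
begin

subsection \<open>Metric measure spaces\<close>

definition borel_of :: "'a topology \<Rightarrow> 'a measure" where
  "borel_of T = sigma (topspace T) {U. openin T U}"

record 'a mm =
  mm_metric :: "'a metric"
  mm_measure :: "'a measure"

definition full_support :: "'a topology \<Rightarrow> 'a measure \<Rightarrow> bool" where
  "full_support T \<mu> \<longleftrightarrow> (\<forall>U. openin T U \<and> U \<noteq> {} \<longrightarrow> 0 < emeasure \<mu> U)"

text \<open>Metric measure spaces are handled through representatives. A separable metric space has at
  most continuum many points, so up to isometry a carrier type such as \<^typ>\<open>real\<close> already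
  provides every equivalence class, and it can accommodate all members of a sequence at once.\<close>

definition mm_space :: "'a mm \<Rightarrow> bool" where
  "mm_space X \<longleftrightarrow>
     mcomplete_of (mm_metric X) \<and>
     separable_space (mtopology_of (mm_metric X)) \<and>
     sets (mm_measure X) = sets (borel_of (mtopology_of (mm_metric X))) \<and>
     prob_space (mm_measure X) \<and>
     full_support (mtopology_of (mm_metric X)) (mm_measure X)"


subsection \<open>The Gromov--Prohorov metric\<close>

definition nbhd :: "'a metric \<Rightarrow> real \<Rightarrow> 'a set \<Rightarrow> 'a set" where
  "nbhd Z \<epsilon> A = {z \<in> mspace Z. \<exists>a\<in>A. mdist Z a z < \<epsilon>}"

definition prohorov_dist :: "'a metric \<Rightarrow> 'a measure \<Rightarrow> 'a measure \<Rightarrow> real" where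
  "prohorov_dist Z \<mu> \<nu> =
     Inf {\<epsilon>. 0 < \<epsilon> \<and> (\<forall>A \<in> sets (borel_of (mtopology_of Z)).
                measure \<mu> A \<le> measure \<nu> (nbhd Z \<epsilon> A) + \<epsilon> \<and>
                measure \<nu> A \<le> measure \<mu> (nbhd Z \<epsilon> A) + \<epsilon>)}"

definition isometric_embedding :: "'a metric \<Rightarrow> 'b metric \<Rightarrow> ('a \<Rightarrow> 'b) \<Rightarrow> bool" where
  "isometric_embedding X Z f \<longleftrightarrow>
     f \<in> mspace X \<rightarrow> mspace Z \<and>
     (\<forall>x\<in>mspace X. \<forall>y\<in>mspace X. mdist Z (f x) (f y) = mdist X x y)"

definition embedded_prohorov ::
  "'a mm \<Rightarrow> 'b mm \<Rightarrow> 'c metric \<Rightarrow> ('a \<Rightarrow> 'c) \<Rightarrow> ('b \<Rightarrow> 'c) \<Rightarrow> real" where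
  "embedded_prohorov X Y Z f g =
     prohorov_dist Z (distr (mm_measure X) (borel_of (mtopology_of Z)) f)
                     (distr (mm_measure Y) (borel_of (mtopology_of Z)) g)"

text \<open>The infimum over all metric spaces \<open>Z\<close> cannot range over all types. It is taken over all
  metric spaces whose points come from the sum type. This loses nothing: only the union of the two
  images matters, and that union is in bijection with a subset of the sum type; see
  \<open>gromov_prohorov_le\<close> below.\<close>

definition gromov_prohorov :: "'a mm \<Rightarrow> 'b mm \<Rightarrow> real" where
  "gromov_prohorov X Y =
     Inf {embedded_prohorov X Y Z f g | (Z :: ('a + 'b) metric) f g.
            isometric_embedding (mm_metric X) Z f \<and> isometric_embedding (mm_metric Y) Z g}"


subsection \<open>The test functions\<close>

text \<open>The entries of an array of size \<open>n\<close> are indexed by the pairs \<open>1 \<le> i < j \<le> n\<close>; outside of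
  these the array is \<^term>\<open>undefined\<close>, so that arrays are determined by their entries.\<close>

definition index_pairs :: "nat \<Rightarrow> (nat \<times> nat) set" where
  "index_pairs n = {(i, j). 1 \<le> i \<and> i < j \<and> j \<le> n}"

datatype array = Empty_array | Array nat "nat \<times> nat \<Rightarrow> real"

definition arrays :: "array set" where
  "arrays = insert Empty_array
     {Array n a | n a. 2 \<le> n \<and> a \<in> index_pairs n \<rightarrow>\<^sub>E {0..}}"

fun chi :: "array \<Rightarrow> 'a mm \<Rightarrow> real" where
  "chi Empty_array X = 1"
| "chi (Array n a) X =
     (\<integral>x. exp (- (\<Sum>(i, j)\<in>index_pairs n. a (i, j) * mdist (mm_metric X) (x i) (x j)))
        \<partial>(\<Pi>\<^sub>M i\<in>{1..n}. mm_measure X))"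


subsection \<open>The choice of the ambient type is immaterial\<close>

lemma space_borel_of [simp]: "space (borel_of T) = topspace T"
  unfolding borel_of_def by (intro space_measure_of) (auto dest: openin_subset)

lemma sets_borel_of: "sets (borel_of T) = sigma_sets (topspace T) {U. openin T U}"
  unfolding borel_of_def by (intro sets_measure_of) (auto dest: openin_subset)

lemma openin_imp_sets_borel_of: "openin T U \<Longrightarrow> U \<in> sets (borel_of T)"
  by (simp add: sets_borel_of)

lemma measurable_borel_of:
  assumes "continuous_map S T f"
  shows "f \<in> borel_of S \<rightarrow>\<^sub>M borel_of T"
  unfolding borel_of_def[of T]
proof (rule measurable_measure_of)
  show "{U. openin T U} \<subseteq> Pow (topspace T)" by (auto dest: openin_subset)
  show "f \<in> space (borel_of S) \<rightarrow> topspace T"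
    using assms by (auto simp: continuous_map_def)
  show "f -` U \<inter> space (borel_of S) \<in> sets (borel_of S)" if "U \<in> {U. openin T U}" for U
  proof -
    have "f -` U \<inter> topspace S = {x \<in> topspace S. f x \<in> U}" by auto
    then show ?thesis
      using assms that by (auto simp: continuous_map_def intro: openin_imp_sets_borel_of)
  qed
qed

lemma isometric_embedding_embedding_map:
  assumes "isometric_embedding X Z f"
  shows "embedding_map (mtopology_of X) (mtopology_of Z) f"
proof -
  interpret Metric_space12 "mspace X" "mdist X" "mspace Z" "mdist Z"
    by (simp add: Metric_space12_mspace_mdist)
  have "embedding_map M1.mtopology M2.mtopology f"
    using assms by (intro isometry_imp_embedding_map) (auto simp: isometric_embedding_def)
  then show ?thesis by (simp add: mtopology_of_def)
qed

lemma isometric_embedding_continuous_map: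
  "isometric_embedding X Z f \<Longrightarrow> continuous_map (mtopology_of X) (mtopology_of Z) f"
  by (metis isometric_embedding_embedding_map embedding_map_def homeomorphic_imp_continuous_map
      continuous_map_in_subtopology)

lemma isometric_embedding_measurable:
  assumes "isometric_embedding X Z f" "sets \<mu> = sets (borel_of (mtopology_of X))"
  shows "f \<in> \<mu> \<rightarrow>\<^sub>M borel_of (mtopology_of Z)"
  using measurable_borel_of[OF isometric_embedding_continuous_map[OF assms(1)]]
  by (simp add: measurable_cong_sets[OF assms(2) refl])

lemma nbhd_openin:
  assumes "A \<subseteq> mspace Z"
  shows "openin (mtopology_of Z) (nbhd Z \<epsilon> A)"
proof -
  have "nbhd Z \<epsilon> A = (\<Union>a\<in>A. mball_of Z a \<epsilon>)"
    using assms by (fastforce simp: nbhd_def)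
  then show ?thesis
    by (auto simp: mball_of_def mtopology_of_def Metric_space.openin_mball)
qed

lemma nbhd_sets:
  assumes "A \<in> sets (borel_of (mtopology_of Z))"
  shows "nbhd Z \<epsilon> A \<in> sets (borel_of (mtopology_of Z))"
  using sets.sets_into_space[OF assms] by (intro openin_imp_sets_borel_of nbhd_openin) simp

lemma prohorov_dist_prob:
  assumes "prob_space \<mu>" "prob_space \<nu>"
  shows "0 \<le> prohorov_dist Z \<mu> \<nu>"
    and "1 \<in> {\<epsilon>. 0 < \<epsilon> \<and> (\<forall>A \<in> sets (borel_of (mtopology_of Z)).
                measure \<mu> A \<le> measure \<nu> (nbhd Z \<epsilon> A) + \<epsilon> \<and>
                measure \<nu> A \<le> measure \<mu> (nbhd Z \<epsilon> A) + \<epsilon>)}"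
proof -
  have "measure \<mu> A \<le> 1" "measure \<nu> A \<le> 1" for A
    using assms by (auto intro: prob_space.prob_le_1)
  then show 1: "1 \<in> {\<epsilon>. 0 < \<epsilon> \<and> (\<forall>A \<in> sets (borel_of (mtopology_of Z)).
                measure \<mu> A \<le> measure \<nu> (nbhd Z \<epsilon> A) + \<epsilon> \<and>
                measure \<nu> A \<le> measure \<mu> (nbhd Z \<epsilon> A) + \<epsilon>)}"
    by (auto intro: add_increasing)
  show "0 \<le> prohorov_dist Z \<mu> \<nu>"
    unfolding prohorov_dist_def using 1 by (intro cInf_greatest) (blast, auto)
qed

lemma embedded_prohorov_nonneg:
  assumes "mm_space X" "mm_space Y"
    and "isometric_embedding (mm_metric X) Z f" "isometric_embedding (mm_metric Y) Z g"
  shows "0 \<le> embedded_prohorov X Y Z f g"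
  unfolding embedded_prohorov_def
  using assms by (intro prohorov_dist_prob(1) prob_space.prob_space_distr
      isometric_embedding_measurable) (auto simp: mm_space_def)

lemma embedded_prohorov_transfer:
  assumes X: "mm_space X" and Y: "mm_space Y"
    and f: "isometric_embedding (mm_metric X) W f" and g: "isometric_embedding (mm_metric Y) W g"
    and k: "isometric_embedding W Z k"
  shows "embedded_prohorov X Y W f g \<le> embedded_prohorov X Y Z (k \<circ> f) (k \<circ> g)"
proof -
  let ?W = "borel_of (mtopology_of W)" and ?Z = "borel_of (mtopology_of Z)"
  let ?\<mu> = "mm_measure X" and ?\<nu> = "mm_measure Y"
  have kf: "isometric_embedding (mm_metric X) Z (k \<circ> f)"
    and kg: "isometric_embedding (mm_metric Y) Z (k \<circ> g)"
    using f g k by (auto simp: isometric_embedding_def Pi_iff)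
  note sets = X[unfolded mm_space_def] Y[unfolded mm_space_def]
  have mf: "f \<in> ?\<mu> \<rightarrow>\<^sub>M ?W" and mkf: "k \<circ> f \<in> ?\<mu> \<rightarrow>\<^sub>M ?Z"
    and mg: "g \<in> ?\<nu> \<rightarrow>\<^sub>M ?W" and mkg: "k \<circ> g \<in> ?\<nu> \<rightarrow>\<^sub>M ?Z"
    using f g kf kg sets by (blast intro: isometric_embedding_measurable)+
  have pZ: "prob_space (distr ?\<mu> ?Z (k \<circ> f))" "prob_space (distr ?\<nu> ?Z (k \<circ> g))"
    using sets mkf mkg by (auto intro: prob_space.prob_space_distr)
  have half: "measure (distr M ?W h) A \<le> measure (distr N ?W h') (nbhd W \<epsilon> A) + \<epsilon>"
    if h: "h \<in> M \<rightarrow>\<^sub>M ?W" and h': "h' \<in> N \<rightarrow>\<^sub>M ?W"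
      and kh: "k \<circ> h \<in> M \<rightarrow>\<^sub>M ?Z" and kh': "k \<circ> h' \<in> N \<rightarrow>\<^sub>M ?Z"
      and M: "prob_space M" and N: "prob_space N"
      and A: "A \<in> sets ?W"
      and \<epsilon>: "\<forall>B\<in>sets ?Z. measure (distr M ?Z (k \<circ> h)) B
                 \<le> measure (distr N ?Z (k \<circ> h')) (nbhd Z \<epsilon> B) + \<epsilon>"
    for M :: "'x measure" and N :: "'y measure" and h h' A \<epsilon>
  proof -
    define B where "B = mtopology_of Z closure_of (k ` A)"
    have AW: "A \<subseteq> mspace W" using sets.sets_into_space[OF A] by simp
    have kW: "k w \<in> mspace Z" if "w \<in> mspace W" for w
      using k that by (auto simp: isometric_embedding_def)
    have kd: "mdist Z (k v) (k w) = mdist W v w" if "v \<in> mspace W" "w \<in> mspace W" for v w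
      using k that by (auto simp: isometric_embedding_def)
    have "openin (mtopology_of Z) (mspace Z - B)"
      unfolding B_def by (metis closedin_closure_of closedin_def topspace_mtopology_of)
    then have "mspace Z - (mspace Z - B) \<in> sets ?Z"
      by (metis openin_imp_sets_borel_of sets.compl_sets space_borel_of topspace_mtopology_of)
    moreover have BZ: "B \<subseteq> mspace Z"
      unfolding B_def by (metis closure_of_subset_topspace topspace_mtopology_of)
    ultimately have B: "B \<in> sets ?Z" by (simp add: double_diff)
    have kAB: "k ` A \<subseteq> B"
      unfolding B_def using AW kW by (intro closure_of_subset) auto
    have near: "w \<in> nbhd W \<epsilon> A" if w: "w \<in> mspace W" "k w \<in> nbhd Z \<epsilon> B" for w
    proof -
      obtain b where b: "b \<in> B" "mdist Z b (k w) < \<epsilon>"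
        using w by (auto simp: nbhd_def)
      then have "\<forall>r>0. \<exists>y\<in>k ` A. y \<in> mball_of Z b r"
        by (auto simp: B_def mtopology_of_def mball_of_def Metric_space.metric_closure_of)
      then obtain a where a: "a \<in> A" "mdist Z b (k a) < \<epsilon> - mdist Z b (k w)"
        using b(2) by (force dest: spec[of _ "\<epsilon> - mdist Z b (k w)"])
      have aW: "a \<in> mspace W" using a AW by blast
      have "mdist W a w = mdist Z (k a) (k w)" using kd aW w by simp
      also have "\<dots> \<le> mdist Z (k a) b + mdist Z b (k w)"
        using b(1) BZ kW aW w by (intro mdist_triangle) auto
      also have "\<dots> < \<epsilon>" using a(2) by (simp add: mdist_commute)
      finally show ?thesis using a(1) w by (auto simp: nbhd_def)
    qed
    interpret M: prob_space M by (rule M)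
    interpret N: prob_space N by (rule N)
    have hW: "h x \<in> mspace W" if "x \<in> space M" for x
      using measurable_space[OF h that] by simp
    have h'W: "h' x \<in> mspace W" if "x \<in> space N" for x
      using measurable_space[OF h' that] by simp
    have "measure (distr M ?W h) A = measure M (h -` A \<inter> space M)"
      using h A by (rule measure_distr)
    also have "\<dots> \<le> measure M ((k \<circ> h) -` B \<inter> space M)"
      using kAB measurable_sets[OF kh B] by (intro M.finite_measure_mono) auto
    also have "\<dots> = measure (distr M ?Z (k \<circ> h)) B"
      using kh B by (rule measure_distr[symmetric])
    also have "\<dots> \<le> measure (distr N ?Z (k \<circ> h')) (nbhd Z \<epsilon> B) + \<epsilon>"
      using \<epsilon> B by blast
    also have "measure (distr N ?Z (k \<circ> h')) (nbhd Z \<epsilon> B)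
               = measure N ((k \<circ> h') -` nbhd Z \<epsilon> B \<inter> space N)"
      using kh' nbhd_sets[OF B] by (rule measure_distr)
    also have "\<dots> \<le> measure N (h' -` nbhd W \<epsilon> A \<inter> space N)"
      using near h'W measurable_sets[OF h' nbhd_sets[OF A]]
      by (intro N.finite_measure_mono) auto
    also have "\<dots> = measure (distr N ?W h') (nbhd W \<epsilon> A)"
      using h' nbhd_sets[OF A] by (rule measure_distr[symmetric])
    finally show ?thesis by simp
  qed
  show ?thesis
    unfolding embedded_prohorov_def prohorov_dist_def
  proof (rule cInf_superset_mono)
    show "{\<epsilon>. 0 < \<epsilon> \<and> (\<forall>A\<in>sets ?Z.
             measure (distr ?\<mu> ?Z (k \<circ> f)) A
               \<le> measure (distr ?\<nu> ?Z (k \<circ> g)) (nbhd Z \<epsilon> A) + \<epsilon> \<and>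
             measure (distr ?\<nu> ?Z (k \<circ> g)) A
               \<le> measure (distr ?\<mu> ?Z (k \<circ> f)) (nbhd Z \<epsilon> A) + \<epsilon>)} \<noteq> {}"
      using prohorov_dist_prob(2)[OF pZ] by blast
  qed (use half[OF mf mg mkf mkg] half[OF mg mf mkg mkf] sets in
        \<open>auto intro!: bdd_belowI[of _ 0]\<close>)
qed

lemma gromov_prohorov_le:
  fixes X :: "'a mm" and Y :: "'b mm" and Z :: "'c metric"
  assumes X: "mm_space X" and Y: "mm_space Y"
    and f: "isometric_embedding (mm_metric X) Z f" and g: "isometric_embedding (mm_metric Y) Z g"
  shows "gromov_prohorov X Y \<le> embedded_prohorov X Y Z f g"
proof -
  define S where "S = mspace (mm_metric X)"
  define T where "T = mspace (mm_metric Y)"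
  define k where "k = case_sum f g"
  define q where "q = (\<lambda>z. if z \<in> f ` S then Inl (inv_into S f z) else Inr (inv_into T g z))"
  define C where "C = q ` (f ` S \<union> g ` T)"
  have kq: "k (q z) = z" if "z \<in> f ` S \<union> g ` T" for z
    using that by (auto simp: k_def q_def f_inv_into_f)
  have im: "f ` S \<subseteq> mspace Z" "g ` T \<subseteq> mspace Z"
    using f g by (auto simp: isometric_embedding_def S_def T_def)
  have kC: "k c \<in> mspace Z" if "c \<in> C" for c
    using that im kq by (auto simp: C_def)
  have kinj: "c = c'" if "c \<in> C" "c' \<in> C" "k c = k c'" for c c'
    using that kq unfolding C_def by (smt (verit) imageE)
  define W where "W = metric (C, \<lambda>c c'. mdist Z (k c) (k c'))"
  have MS: "Metric_space C (\<lambda>c c'. mdist Z (k c) (k c'))"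
  proof
    show "(mdist Z (k c) (k c') = 0) = (c = c')" if "c \<in> C" "c' \<in> C" for c c'
      using that kC kinj by auto
  qed (auto simp: mdist_commute kC intro: mdist_triangle)
  have W: "mspace W = C" "mdist W = (\<lambda>c c'. mdist Z (k c) (k c'))"
    unfolding W_def using MS by (simp_all add: Metric_space.mspace_metric Metric_space.mdist_metric)
  have k: "isometric_embedding W Z k"
    using kC by (auto simp: isometric_embedding_def W)
  have qf: "isometric_embedding (mm_metric X) W (q \<circ> f)"
    using f kq by (auto simp: isometric_embedding_def W C_def S_def)
  have qg: "isometric_embedding (mm_metric Y) W (q \<circ> g)"
    using g kq by (auto simp: isometric_embedding_def W C_def T_def)
  have "embedded_prohorov X Y W (q \<circ> f) (q \<circ> g)
          \<le> embedded_prohorov X Y Z (k \<circ> (q \<circ> f)) (k \<circ> (q \<circ> g))"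
    using X Y qf qg k by (rule embedded_prohorov_transfer)
  also have "\<dots> = embedded_prohorov X Y Z f g"
  proof -
    have sp: "space (mm_measure X) = S" "space (mm_measure Y) = T"
      using X Y sets_eq_imp_space_eq[of "mm_measure X"] sets_eq_imp_space_eq[of "mm_measure Y"]
      by (auto simp: mm_space_def S_def T_def)
    have "distr (mm_measure X) (borel_of (mtopology_of Z)) (k \<circ> (q \<circ> f))
            = distr (mm_measure X) (borel_of (mtopology_of Z)) f"
      using kq by (intro distr_cong) (auto simp: sp)
    moreover have "distr (mm_measure Y) (borel_of (mtopology_of Z)) (k \<circ> (q \<circ> g))
            = distr (mm_measure Y) (borel_of (mtopology_of Z)) g"
      using kq by (intro distr_cong) (auto simp: sp)
    ultimately show ?thesis by (simp add: embedded_prohorov_def)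
  qed
  finally have le: "embedded_prohorov X Y W (q \<circ> f) (q \<circ> g) \<le> embedded_prohorov X Y Z f g" .
  have "gromov_prohorov X Y \<le> embedded_prohorov X Y W (q \<circ> f) (q \<circ> g)"
    unfolding gromov_prohorov_def
  proof (rule cInf_lower)
    show "embedded_prohorov X Y W (q \<circ> f) (q \<circ> g) \<in>
          {embedded_prohorov X Y Z f g | (Z :: ('a + 'b) metric) f g.
            isometric_embedding (mm_metric X) Z f \<and> isometric_embedding (mm_metric Y) Z g}"
      using qf qg by blast
    show "bdd_below {embedded_prohorov X Y Z f g | (Z :: ('a + 'b) metric) f g.
            isometric_embedding (mm_metric X) Z f \<and> isometric_embedding (mm_metric Y) Z g}"
      using embedded_prohorov_nonneg[OF X Y] by (intro bdd_belowI[of _ 0]) blast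
  qed
  with le show ?thesis by linarith
qed

end

theory Submission
  imports Defs
begin

text \<open>
  From Gromov--Prohorov convergence to the \<open>\<chi>\<^sub>A\<close>. Two spaces at distance less than \<open>\<epsilon>\<close> sit in one
  metric space \<open>Z\<close> in which their measures are \<open>\<epsilon>\<close>-close in the Prohorov sense. A \<open>[0,1]\<close>-valued
  \<open>L\<close>-Lipschitz function then has integrals differing by at most \<open>(L + 1) \<epsilon>\<close>, because the
  \<open>\<epsilon>\<close>-neighbourhood of \<open>{h > t}\<close> lies in \<open>{h > t - L \<epsilon>}\<close>. The integrand of \<open>\<chi>\<^sub>A\<close> is Lipschitz in
  each of its finitely many arguments, so the sampled points can be moved from one space to the
  other one at a time (\<open>embedded_integral_close\<close>). Measurability on
  products comes from the Lipschitz property and the separability of the two mm-spaces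
  (\<open>lip_on_measurable\<close>).

  From the \<open>\<chi>\<^sub>A\<close> to Gromov--Prohorov convergence. Since the limit \<open>Y\<close> is given, it suffices to
  find in \<open>X\<^sub>n\<close>, for large \<open>n\<close>, a copy of a finite net of \<open>Y\<close>. Let \<open>y\<^sub>1, \<dots>, y\<^sub>K\<close> be
  points of \<open>Y\<close> whose \<open>\<delta>\<close>-balls together cover mass above \<open>1 - \<delta>\<close>. If \<open>x\<^sub>1, \<dots>, x\<^sub>K\<close> in \<open>X\<^sub>n\<close> have almost
  the same mutual distances, and for every set \<open>J\<close> of indices the union of the \<open>\<delta>\<close>-balls around the
  \<open>y\<^sub>i\<close> with \<open>i \<in> J\<close> has at most \<open>\<delta>\<close> more mass than the union of the \<open>2\<delta>\<close>-balls around the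
  corresponding \<open>x\<^sub>i\<close>, then gluing the spaces along the nets at distance \<open>\<delta>\<close> shows that they are
  \<open>4\<delta>\<close>-close (\<open>gromov_prohorov_le_of_nets\<close>).

  These requirements say that finitely many numbers attached to \<open>x\<close> are close to the corresponding
  numbers attached to \<open>y\<close>: the \<open>exp (- r (x\<^sub>i, x\<^sub>j))\<close>, and the means over a sampled point \<open>u\<close> of
  products of a polynomial cutoff function in \<open>exp (- r (x\<^sub>i, u))\<close>. The integral over \<open>x\<close> of any
  polynomial in these numbers converges to its counterpart in \<open>Y\<close>, because each factor that is a
  mean can be absorbed by sampling one more point, so that the integral of a monomial is some \<open>\<chi>\<^sub>A\<close>. Consider
  a polynomial that peaks where the numbers are those of \<open>y\<close>. The integrals of its powers over \<open>Y\<close>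
  decay slowly, since \<open>y\<close> belongs to the support; over an \<open>X\<^sub>n\<close> without a suitable \<open>x\<close> they would
  decay at a faster exponential rate, so a single high power shows that \<open>X\<^sub>n\<close> contains a suitable \<open>x\<close>
  for all large \<open>n\<close> (\<open>eventually_realised\<close>).
\<close>

section \<open>Lipschitz functions on powers of a metric measure space\<close>

lemma mm_space_space:
  assumes "mm_space X"
  shows "space (mm_measure X) = mspace (mm_metric X)"
  using assms sets_eq_imp_space_eq[of "mm_measure X"] by (auto simp: mm_space_def)

lemma mm_space_prob: "mm_space X \<Longrightarrow> prob_space (mm_measure X)"
  by (simp add: mm_space_def)

lemma openin_mtopology_of:
  "openin (mtopology_of Z) U \<longleftrightarrow>
     U \<subseteq> mspace Z \<and> (\<forall>x\<in>U. \<exists>r>0. \<forall>y\<in>mspace Z. mdist Z x y < r \<longrightarrow> y \<in> U)"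
proof -
  have "mball_of Z x r \<subseteq> U \<longleftrightarrow> (\<forall>y\<in>mspace Z. mdist Z x y < r \<longrightarrow> y \<in> U)"
    if "U \<subseteq> mspace Z" "x \<in> U" for x r
    using that by (auto simp: subset_iff)
  then show ?thesis
    unfolding mtopology_of_def Metric_space.openin_mtopology[OF Metric_space_mspace_mdist]
      mball_of_def by (intro conj_cong refl ball_cong ex_cong) blast
qed

lemma openin_open_ball: "openin (mtopology_of Z) {y \<in> mspace Z. mdist Z x y < r}"
  if x: "x \<in> mspace Z"
  unfolding openin_mtopology_of
proof safe
  fix y assume y: "y \<in> mspace Z" "mdist Z x y < r"
  have "mdist Z x z < r" if "z \<in> mspace Z" "mdist Z y z < r - mdist Z x y" for z
    using mdist_triangle[OF x y(1) that(1)] that by simp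
  then show "\<exists>s>0. \<forall>z\<in>mspace Z. mdist Z y z < s \<longrightarrow> z \<in> {y \<in> mspace Z. mdist Z x y < r}"
    using y by (intro exI[of _ "r - mdist Z x y"]) auto
qed

lemma mm_space_ball_sets:
  assumes "mm_space X" "x \<in> mspace (mm_metric X)"
  shows "{y \<in> mspace (mm_metric X). mdist (mm_metric X) x y < r} \<in> sets (mm_measure X)"
  using assms openin_imp_sets_borel_of[OF openin_open_ball] by (simp add: mm_space_def)

lemma mm_space_dense_subset:
  assumes "mm_space X"
  obtains C where "countable C" "C \<subseteq> mspace (mm_metric X)"
    "\<And>x e. x \<in> mspace (mm_metric X) \<Longrightarrow> 0 < e \<Longrightarrow> \<exists>c\<in>C. mdist (mm_metric X) c x < e"
proof -
  obtain C where C: "countable C" "C \<subseteq> mspace (mm_metric X)"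
    "mtopology_of (mm_metric X) closure_of C = mspace (mm_metric X)"
    using assms by (auto simp: mm_space_def separable_space_def)
  have "\<exists>c\<in>C. mdist (mm_metric X) c x < e" if "x \<in> mspace (mm_metric X)" "0 < e" for x e
  proof -
    have "x \<in> mtopology_of (mm_metric X) closure_of C" using C that by simp
    then have "\<exists>c\<in>C. c \<in> mball_of (mm_metric X) x e"
      using that(2) by (auto simp: mtopology_of_def mball_of_def Metric_space.metric_closure_of)
    then show ?thesis by (auto simp: mdist_commute)
  qed
  with C that show thesis by blast
qed

text \<open>The sets \<open>{h < t}\<close> are open. This is for the space \<open>Z\<close> in which two mm-spaces are embedded and
  which may fail to be separable.\<close>

lemma lipschitz_measurable_borel_of:
  assumes L: "\<And>z w. z \<in> mspace Z \<Longrightarrow> w \<in> mspace Z \<Longrightarrow> \<bar>h z - h w\<bar> \<le> L * mdist Z z w"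
  shows "h \<in> borel_measurable (borel_of (mtopology_of Z))"
proof (rule borel_measurableI_less)
  fix t
  have "openin (mtopology_of Z) {z \<in> mspace Z. h z < t}"
    unfolding openin_mtopology_of
  proof safe
    fix z assume z: "z \<in> mspace Z" "h z < t"
    have "h w < t" if w: "w \<in> mspace Z" "mdist Z z w < (t - h z) / (\<bar>L\<bar> + 1)" for w
    proof -
      have "h w \<le> h z + L * mdist Z z w" using L[OF z(1) w(1)] by linarith
      also have "L * mdist Z z w \<le> (\<bar>L\<bar> + 1) * mdist Z z w"
        by (intro mult_right_mono) auto
      also have "\<dots> < t - h z" using w by (simp add: field_simps)
      finally show ?thesis by simp
    qed
    then show "\<exists>r>0. \<forall>y\<in>mspace Z. mdist Z z y < r \<longrightarrow> y \<in> {z \<in> mspace Z. h z < t}"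
      using z by (intro exI[of _ "(t - h z) / (\<bar>L\<bar> + 1)"]) (auto simp: add_nonneg_pos)
  qed
  then show "{x \<in> space (borel_of (mtopology_of Z)). h x < t} \<in> sets (borel_of (mtopology_of Z))"
    by (simp add: openin_imp_sets_borel_of)
qed

text \<open>The arguments are functions on the index set \<open>J\<close>, and distances are added over \<open>J\<close>. The
  bound forces \<open>F\<close> to ignore coordinates outside \<open>J\<close>, which makes restriction and insertion of
  coordinates harmless.\<close>

definition lip_on :: "'c metric \<Rightarrow> 'i set \<Rightarrow> real \<Rightarrow> (('i \<Rightarrow> 'c) \<Rightarrow> real) \<Rightarrow> bool" where
  "lip_on Z J L F \<longleftrightarrow> 0 \<le> L \<and> (\<forall>z \<in> J \<rightarrow> mspace Z. \<forall>w \<in> J \<rightarrow> mspace Z.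
     \<bar>F z - F w\<bar> \<le> L * (\<Sum>i\<in>J. mdist Z (z i) (w i)))"

lemma lip_onD:
  assumes "lip_on Z J L F" "z \<in> J \<rightarrow> mspace Z" "w \<in> J \<rightarrow> mspace Z"
  shows "\<bar>F z - F w\<bar> \<le> L * (\<Sum>i\<in>J. mdist Z (z i) (w i))"
  using assms by (auto simp: lip_on_def)

lemma lip_on_cong:
  assumes "lip_on Z J L F" "z \<in> J \<rightarrow> mspace Z" "\<And>i. i \<in> J \<Longrightarrow> w i = z i"
  shows "F w = F z"
proof -
  have "\<bar>F z - F w\<bar> \<le> L * (\<Sum>i\<in>J. mdist Z (z i) (w i))"
    using assms by (intro lip_onD) (auto simp: Pi_iff)
  also have "(\<Sum>i\<in>J. mdist Z (z i) (w i)) = 0"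
    using assms(2,3) by (intro sum.neutral) (auto simp: Pi_iff)
  finally show ?thesis by simp
qed

lemma lip_on_subset:
  assumes "lip_on Z J L F" "J \<subseteq> J'" "finite J'"
  shows "lip_on Z J' L F"
  unfolding lip_on_def
proof (intro conjI ballI)
  show "0 \<le> L" using assms by (simp add: lip_on_def)
  fix z w assume "z \<in> J' \<rightarrow> mspace Z" "w \<in> J' \<rightarrow> mspace Z"
  then have "\<bar>F z - F w\<bar> \<le> L * (\<Sum>i\<in>J. mdist Z (z i) (w i))"
    using assms by (intro lip_onD) auto
  also have "\<dots> \<le> L * (\<Sum>i\<in>J'. mdist Z (z i) (w i))"
    using assms by (intro mult_left_mono sum_mono2) (auto simp: lip_on_def)
  finally show "\<bar>F z - F w\<bar> \<le> L * (\<Sum>i\<in>J'. mdist Z (z i) (w i))" .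
qed

lemma lip_on_compose_isometry:
  assumes "lip_on Z J L F" "isometric_embedding W Z f"
  shows "lip_on W J L (\<lambda>x. F (\<lambda>i. f (x i)))"
  unfolding lip_on_def
proof (intro conjI ballI)
  show "0 \<le> L" using assms by (simp add: lip_on_def)
  fix z w assume *: "z \<in> J \<rightarrow> mspace W" "w \<in> J \<rightarrow> mspace W"
  have "\<bar>F (\<lambda>i. f (z i)) - F (\<lambda>i. f (w i))\<bar> \<le> L * (\<Sum>i\<in>J. mdist Z (f (z i)) (f (w i)))"
    using assms * by (intro lip_onD) (auto simp: isometric_embedding_def Pi_iff)
  also have "(\<Sum>i\<in>J. mdist Z (f (z i)) (f (w i))) = (\<Sum>i\<in>J. mdist W (z i) (w i))"
    using assms(2) * by (intro sum.cong) (auto simp: isometric_embedding_def Pi_iff)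
  finally show "\<bar>F (\<lambda>i. f (z i)) - F (\<lambda>i. f (w i))\<bar> \<le> L * (\<Sum>i\<in>J. mdist W (z i) (w i))" .
qed

lemma lip_on_slice:
  assumes "lip_on Z (insert i J) L F" "i \<notin> J" "finite J" "z \<in> J \<rightarrow> mspace Z"
    "u \<in> mspace Z" "v \<in> mspace Z"
  shows "\<bar>F (z(i := u)) - F (z(i := v))\<bar> \<le> L * mdist Z u v"
proof -
  have "\<bar>F (z(i := u)) - F (z(i := v))\<bar>
      \<le> L * (\<Sum>k\<in>insert i J. mdist Z ((z(i := u)) k) ((z(i := v)) k))"
    using assms by (intro lip_onD) auto
  also have "(\<Sum>k\<in>insert i J. mdist Z ((z(i := u)) k) ((z(i := v)) k)) = mdist Z u v"
    using assms by (auto simp: Pi_iff intro!: sum.neutral)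
  finally show ?thesis .
qed

lemma space_PiM_mm:
  assumes "mm_space X"
  shows "space (PiM J (\<lambda>_. mm_measure X)) = J \<rightarrow>\<^sub>E mspace (mm_metric X)"
  by (simp add: space_PiM mm_space_space[OF assms])

text \<open>The open box around a point \<open>c\<close> of a countable dense set, with side \<open>q\<close>, lies in \<open>{F < t}\<close> as
  soon as \<open>F c\<close> is below \<open>t\<close> by \<open>L\<close> times the diameter of the box, and countably many such boxes
  with rational \<open>q\<close> exhaust \<open>{F < t}\<close>. Boxes belong to the product of the Borel algebras, whereas arbitrary open sets of a
  product of metric spaces need not.\<close>

lemma lip_on_measurable:
  assumes X: "mm_space X" and J: "finite J" and F: "lip_on (mm_metric X) J L F"
  shows "F \<in> borel_measurable (PiM J (\<lambda>_. mm_measure X))"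
proof (rule borel_measurableI_less)
  fix t
  let ?S = "mspace (mm_metric X)" and ?d = "mdist (mm_metric X)"
  let ?P = "PiM J (\<lambda>_. mm_measure X)"
  obtain C where C: "countable C" "C \<subseteq> ?S" "\<And>x e. x \<in> ?S \<Longrightarrow> 0 < e \<Longrightarrow> \<exists>c\<in>C. ?d c x < e"
    using mm_space_dense_subset[OF X] by metis
  have L: "0 \<le> L" using F by (simp add: lip_on_def)
  define D where "D = {(c, q :: real). c \<in> J \<rightarrow>\<^sub>E C \<and> q \<in> \<rat> \<and> F c + L * (card J * q) < t}"
  have "D \<subseteq> (J \<rightarrow>\<^sub>E C) \<times> \<rat>" by (auto simp: D_def)
  then have cD: "countable D"
    using countable_PiE[OF J] C(1) by (meson countable_SIGMA countable_rat countable_subset)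
  define U where "U = (\<lambda>(c, q). \<Pi>\<^sub>E i\<in>J. {y \<in> ?S. ?d (c i) y < q})"
  have "{x \<in> space ?P. F x < t} = (\<Union>p\<in>D. U p)"
  proof (intro equalityI subsetI)
    fix x assume "x \<in> {x \<in> space ?P. F x < t}"
    then have x: "x \<in> J \<rightarrow>\<^sub>E ?S" "F x < t" by (auto simp: space_PiM_mm[OF X])
    (* passing from x to c and then to the whole box costs L * card J * q each *)
    define s where "s = (t - F x) / (2 * (L * card J) + 1)"
    have den: "0 < 2 * (L * card J) + 1" using L by (intro add_nonneg_pos) auto
    have "0 < s" unfolding s_def using x den by (intro divide_pos_pos) auto
    then obtain q where q: "q \<in> \<rat>" "0 < q" "q < s"
      using Rats_dense_in_real by blast
    have "\<forall>i\<in>J. \<exists>c\<in>C. ?d c (x i) < q" using C(3) q(2) x by blast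
    then obtain c0 where c0: "\<And>i. i \<in> J \<Longrightarrow> c0 i \<in> C \<and> ?d (c0 i) (x i) < q" by metis
    define c where "c = restrict c0 J"
    have c: "c \<in> J \<rightarrow>\<^sub>E C" "\<And>i. i \<in> J \<Longrightarrow> ?d (c i) (x i) < q" using c0 by (auto simp: c_def)
    have "\<bar>F c - F x\<bar> \<le> L * (\<Sum>i\<in>J. ?d (c i) (x i))"
      using F c C(2) x by (intro lip_onD) (auto simp: PiE_def Pi_iff)
    also have "\<dots> \<le> L * (card J * q)"
      using L c(2) by (intro mult_left_mono sum_bounded_above) (auto simp: less_imp_le)
    finally have "F c + L * (card J * q) \<le> F x + (2 * (L * card J)) * q" by (simp add: algebra_simps)
    also have "\<dots> \<le> F x + (2 * (L * card J) + 1) * q" using q by (simp add: algebra_simps)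
    also have "\<dots> < F x + (2 * (L * card J) + 1) * s" using q den by simp
    also have "\<dots> = t" using den by (simp add: s_def)
    finally have "(c, q) \<in> D" using c q by (simp add: D_def)
    moreover have "x \<in> U (c, q)" using x c by (auto simp: U_def PiE_def Pi_iff)
    ultimately show "x \<in> (\<Union>p\<in>D. U p)" by blast
  next
    fix x assume "x \<in> (\<Union>p\<in>D. U p)"
    then obtain c and q :: real where c: "c \<in> J \<rightarrow>\<^sub>E C" "F c + L * (card J * q) < t"
      and x: "x \<in> (\<Pi>\<^sub>E i\<in>J. {y \<in> ?S. ?d (c i) y < q})"
      by (auto simp: D_def U_def)
    have "\<bar>F c - F x\<bar> \<le> L * (\<Sum>i\<in>J. ?d (c i) (x i))"
      using F c C(2) x by (intro lip_onD) (auto simp: PiE_def Pi_iff)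
    also have "\<dots> \<le> L * (card J * q)"
      using L x by (intro mult_left_mono sum_bounded_above) (auto simp: PiE_def Pi_iff less_imp_le)
    finally have "F x < t" using c by linarith
    moreover have "x \<in> J \<rightarrow>\<^sub>E ?S" using x by (auto simp: PiE_def Pi_iff)
    ultimately show "x \<in> {x \<in> space ?P. F x < t}" by (simp add: space_PiM_mm[OF X])
  qed
  moreover have "U p \<in> sets ?P" if "p \<in> D" for p
    using that C(2) J unfolding U_def D_def
    by (auto intro!: sets_PiM_I_finite mm_space_ball_sets[OF X])
  ultimately show "{x \<in> space ?P. F x < t} \<in> sets ?P"
    using cD by (auto intro: sets.countable_UN')
qed

lemma prob_space_PiM_mm:
  "mm_space X \<Longrightarrow> prob_space (PiM J (\<lambda>_. mm_measure X))"
  by (intro prob_space_PiM mm_space_prob)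

lemma lip_on_integrable:
  assumes X: "mm_space X" and J: "finite J" and F: "lip_on (mm_metric X) J L F"
    and B: "\<And>x. x \<in> J \<rightarrow> mspace (mm_metric X) \<Longrightarrow> \<bar>F x\<bar> \<le> B"
  shows "integrable (PiM J (\<lambda>_. mm_measure X)) F"
proof -
  interpret P: prob_space "PiM J (\<lambda>_. mm_measure X)" by (rule prob_space_PiM_mm[OF X])
  show ?thesis
    using B by (intro P.integrable_const_bound[where B = B] lip_on_measurable[OF X J F] AE_I2)
      (auto simp: space_PiM_mm[OF X] PiE_def)
qed

lemma lip_on_integral_insert:
  assumes X: "mm_space X" and J: "finite J" "i \<notin> J"
    and F: "lip_on (mm_metric X) (insert i J) L F"
    and B: "\<And>x. x \<in> insert i J \<rightarrow> mspace (mm_metric X) \<Longrightarrow> \<bar>F x\<bar> \<le> B"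
  shows "(\<integral>x. F x \<partial>PiM (insert i J) (\<lambda>_. mm_measure X)) =
    (\<integral>x. (\<integral>y. F (x(i := y)) \<partial>mm_measure X) \<partial>PiM J (\<lambda>_. mm_measure X))"
proof -
  interpret p: prob_space "mm_measure X" by (rule mm_space_prob[OF X])
  interpret product_sigma_finite "\<lambda>_. mm_measure X" ..
  show ?thesis
    using J X F B by (intro product_integral_insert lip_on_integrable[where B = B and L = L]) auto
qed

lemma lip_on_integral:
  assumes M: "prob_space M" and h: "\<And>y. y \<in> space M \<Longrightarrow> h y \<in> mspace Z"
    and J: "finite J" "i \<notin> J" and F: "lip_on Z (insert i J) L F"
    and int: "\<And>z. z \<in> J \<rightarrow> mspace Z \<Longrightarrow> integrable M (\<lambda>y. F (z(i := h y)))"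
  shows "lip_on Z J L (\<lambda>z. \<integral>y. F (z(i := h y)) \<partial>M)"
  unfolding lip_on_def
proof (intro conjI ballI)
  interpret prob_space M by (rule M)
  show "0 \<le> L" using F by (simp add: lip_on_def)
  fix z w assume zw: "z \<in> J \<rightarrow> mspace Z" "w \<in> J \<rightarrow> mspace Z"
  have le: "\<bar>F (z(i := h y)) - F (w(i := h y))\<bar> \<le> L * (\<Sum>j\<in>J. mdist Z (z j) (w j))"
    if "y \<in> space M" for y
  proof -
    have "\<bar>F (z(i := h y)) - F (w(i := h y))\<bar> \<le>
      L * (\<Sum>j\<in>insert i J. mdist Z ((z(i := h y)) j) ((w(i := h y)) j))"
      using zw h[OF that] by (intro lip_onD[OF F]) auto
    also have "(\<Sum>j\<in>insert i J. mdist Z ((z(i := h y)) j) ((w(i := h y)) j)) =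
        (\<Sum>j\<in>J. mdist Z (z j) (w j))"
    proof -
      have "(\<Sum>j\<in>J. mdist Z ((z(i := h y)) j) ((w(i := h y)) j)) = (\<Sum>j\<in>J. mdist Z (z j) (w j))"
        using J by (intro sum.cong) auto
      then show ?thesis using J h[OF that] by simp
    qed
    finally show ?thesis .
  qed
  have "\<bar>(\<integral>y. F (z(i := h y)) \<partial>M) - (\<integral>y. F (w(i := h y)) \<partial>M)\<bar> =
      \<bar>\<integral>y. F (z(i := h y)) - F (w(i := h y)) \<partial>M\<bar>"
    using zw int by (subst Bochner_Integration.integral_diff) auto
  also have "\<dots> \<le> (\<integral>y. \<bar>F (z(i := h y)) - F (w(i := h y))\<bar> \<partial>M)"
    by (rule integral_abs_bound)
  also have "\<dots> \<le> (\<integral>y. L * (\<Sum>j\<in>J. mdist Z (z j) (w j)) \<partial>M)"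
    using zw int le by (intro integral_mono) auto
  also have "\<dots> = L * (\<Sum>j\<in>J. mdist Z (z j) (w j))" by (simp add: prob_space)
  finally show "\<bar>(\<integral>y. F (z(i := h y)) \<partial>M) - (\<integral>y. F (w(i := h y)) \<partial>M)\<bar> \<le>
    L * (\<Sum>j\<in>J. mdist Z (z j) (w j))" .
qed

lemma lip_on_slice_integrable:
  assumes X: "mm_space X" and f: "isometric_embedding (mm_metric X) Z f"
    and J: "finite J" "i \<notin> J" and F: "lip_on Z (insert i J) L F"
    and B: "\<And>z. z \<in> insert i J \<rightarrow> mspace Z \<Longrightarrow> \<bar>F z\<bar> \<le> B"
    and z: "z \<in> J \<rightarrow> mspace Z"
  shows "integrable (mm_measure X) (\<lambda>y. F (z(i := f y)))"
proof -
  interpret p: prob_space "mm_measure X" by (rule mm_space_prob[OF X])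
  have fZ: "f y \<in> mspace Z" if "y \<in> space (mm_measure X)" for y
    using f that by (auto simp: isometric_embedding_def mm_space_space[OF X])
  have "(\<lambda>v. F (z(i := v))) \<in> borel_measurable (borel_of (mtopology_of Z))"
    using lip_on_slice[OF F J(2,1) z] by (rule lipschitz_measurable_borel_of)
  moreover have "f \<in> mm_measure X \<rightarrow>\<^sub>M borel_of (mtopology_of Z)"
    using f X by (intro isometric_embedding_measurable) (auto simp: mm_space_def)
  ultimately have "(\<lambda>y. F (z(i := f y))) \<in> borel_measurable (mm_measure X)"
    by (rule measurable_compose_rev)
  then show ?thesis
    using z fZ by (intro p.integrable_const_bound[where B = B] AE_I2) (auto intro!: B)
qed

section \<open>Prohorov closeness and integrals of Lipschitz functions\<close>

text \<open>For \<open>h\<close> with values in \<open>[0,1]\<close> the right-hand side is the integral of \<open>h\<close>. The truncation to levels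
  \<open>t \<le> 1\<close> keeps the additive error \<open>\<epsilon>\<close> of the Prohorov condition integrable over \<open>t\<close>.\<close>

lemma truncated_layer_cake:
  fixes h :: "'a \<Rightarrow> real"
  assumes M: "prob_space M" and h[measurable]: "h \<in> borel_measurable M"
  shows "(\<integral>\<^sup>+t. emeasure M {z \<in> space M. t < h z} * indicator {0..1} t \<partial>lborel) =
    (\<integral>\<^sup>+z. emeasure lborel {t. 0 \<le> t \<and> t \<le> 1 \<and> t < h z} \<partial>M)"
proof -
  interpret prob_space M by (rule M)
  interpret pair_sigma_finite M lborel ..
  have "(\<integral>\<^sup>+t. (\<integral>\<^sup>+z. indicator {0..1} t * indicator {..<h z} t \<partial>M) \<partial>lborel) =
      (\<integral>\<^sup>+z. (\<integral>\<^sup>+t. indicator {0..1} t * indicator {..<h z} t \<partial>lborel) \<partial>M)"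
  proof (rule Fubini')
    have "(\<lambda>p. if snd p \<in> {0..1} then if snd p < h (fst p) then 1 else 0 else 0 :: ennreal)
        \<in> borel_measurable (M \<Otimes>\<^sub>M borel)"
      by measurable
    then have "(\<lambda>p. if snd p \<in> {0..1} then if snd p < h (fst p) then 1 else 0 else 0 :: ennreal)
        \<in> borel_measurable (M \<Otimes>\<^sub>M lborel)"
      by (simp add: measurable_cong_sets[OF sets_pair_measure_cong[OF refl sets_lborel] refl])
    also have "(\<lambda>p. if snd p \<in> {0..1} then if snd p < h (fst p) then 1 else 0 else 0 :: ennreal) =
        (\<lambda>(z, t). indicator {0..1} t * indicator {..<h z} t)"
      by (auto simp: indicator_def)
    finally show "(\<lambda>(z, t). indicator {0..1} t * indicator {..<h z} t :: ennreal)
        \<in> borel_measurable (M \<Otimes>\<^sub>M lborel)" .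
  qed
  moreover have "(\<integral>\<^sup>+z. indicator {0..1} t * indicator {..<h z} t \<partial>M) =
      emeasure M {z \<in> space M. t < h z} * indicator {0..1} t" for t
  proof -
    have "(\<integral>\<^sup>+z. indicator {0..1} t * indicator {..<h z} t \<partial>M) =
        (\<integral>\<^sup>+z. indicator {0..1} t * indicator {z \<in> space M. t < h z} z \<partial>M)"
      by (intro nn_integral_cong) (auto simp: indicator_def)
    also have "\<dots> = indicator {0..1} t * emeasure M {z \<in> space M. t < h z}"
      by (intro nn_integral_cmult_indicator) measurable
    finally show ?thesis by (simp add: mult.commute)
  qed
  moreover have "(\<integral>\<^sup>+t. indicator {0..1} t * indicator {..<h z} t \<partial>lborel) =
      emeasure lborel {t. 0 \<le> t \<and> t \<le> 1 \<and> t < h z}" for z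
  proof -
    have "(\<integral>\<^sup>+t. indicator {0..1} t * indicator {..<h z} t \<partial>lborel) =
        (\<integral>\<^sup>+t. indicator ({0..1} \<inter> {..<h z}) t \<partial>lborel)"
      by (intro nn_integral_cong) (auto simp: indicator_def)
    also have "\<dots> = emeasure lborel ({0..1} \<inter> {..<h z})" by (subst nn_integral_indicator) auto
    also have "{0..1} \<inter> {..<h z} = {t. 0 \<le> t \<and> t \<le> 1 \<and> t < h z}" by auto
    finally show ?thesis .
  qed
  ultimately show ?thesis by simp
qed

text \<open>The \<open>e\<close>-neighbourhood of \<open>{h > t}\<close> is contained in \<open>{h + L e > t}\<close>, so integrating the Prohorov
  condition over the levels \<open>t \<in> [0,1]\<close> compares the integral of \<open>h\<close> with that of \<open>h + L e\<close>, at the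
  cost of another \<open>e\<close>.\<close>

lemma prohorov_integral_le:
  assumes \<mu>: "prob_space \<mu>" "sets \<mu> = sets (borel_of (mtopology_of Z))"
    and \<nu>: "prob_space \<nu>" "sets \<nu> = sets (borel_of (mtopology_of Z))"
    and e: "0 < e" and le: "\<And>A. A \<in> sets (borel_of (mtopology_of Z)) \<Longrightarrow>
      measure \<mu> A \<le> measure \<nu> (nbhd Z e A) + e"
    and L: "0 \<le> L" "\<And>z w. z \<in> mspace Z \<Longrightarrow> w \<in> mspace Z \<Longrightarrow> \<bar>h z - h w\<bar> \<le> L * mdist Z z w"
    and h: "\<And>z. z \<in> mspace Z \<Longrightarrow> 0 \<le> h z \<and> h z \<le> 1"
  shows "(\<integral>z. h z \<partial>\<mu>) \<le> (\<integral>z. h z \<partial>\<nu>) + (L + 1) * e"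
proof -
  interpret \<mu>: prob_space \<mu> by fact
  interpret \<nu>: prob_space \<nu> by fact
  have sp: "space \<mu> = mspace Z" "space \<nu> = mspace Z"
    using sets_eq_imp_space_eq[OF \<mu>(2)] sets_eq_imp_space_eq[OF \<nu>(2)] by simp_all
  have hB: "h \<in> borel_measurable (borel_of (mtopology_of Z))"
    using L(2) by (rule lipschitz_measurable_borel_of)
  have [measurable]: "h \<in> borel_measurable \<mu>" "h \<in> borel_measurable \<nu>"
    using hB by (simp_all add: measurable_cong_sets[OF \<mu>(2) refl] measurable_cong_sets[OF \<nu>(2) refl])
  have int: "integrable \<mu> h" "integrable \<nu> h"
    using h by (auto intro!: \<mu>.integrable_const_bound[where B = 1] \<nu>.integrable_const_bound[where B = 1] simp: sp)
  have nonneg: "0 \<le> (\<integral>z. h z \<partial>\<nu>)" using h by (intro integral_nonneg_AE AE_I2) (auto simp: sp)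
  have slab: "{t. 0 \<le> t \<and> t \<le> 1 \<and> t < r} = {0..<r}" if "r \<le> 1" for r :: real using that by auto
  have "ennreal (\<integral>z. h z \<partial>\<mu>) = (\<integral>\<^sup>+z. ennreal (h z) \<partial>\<mu>)"
    using h int by (intro nn_integral_eq_integral[symmetric] AE_I2) (auto simp: sp)
  also have "\<dots> = (\<integral>\<^sup>+z. emeasure lborel {t. 0 \<le> t \<and> t \<le> 1 \<and> t < h z} \<partial>\<mu>)"
    using h by (intro nn_integral_cong) (auto simp: sp slab)
  also have "\<dots> = (\<integral>\<^sup>+t. emeasure \<mu> {z \<in> space \<mu>. t < h z} * indicator {0..1} t \<partial>lborel)"
    by (subst truncated_layer_cake[OF \<mu>(1)]) auto
  also have "\<dots> \<le> (\<integral>\<^sup>+t. emeasure \<nu> {z \<in> space \<nu>. t < h z + L * e} * indicator {0..1} t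
      + ennreal e * indicator {0..1} t \<partial>lborel)"
  proof (rule nn_integral_mono)
    fix t
    let ?A = "{z \<in> mspace Z. t < h z}"
    have A: "?A \<in> sets (borel_of (mtopology_of Z))"
      using borel_measurable_iff_greater[THEN iffD1, OF hB] by simp
    have "nbhd Z e ?A \<subseteq> {z \<in> space \<nu>. t < h z + L * e}"
    proof
      fix z assume "z \<in> nbhd Z e ?A"
      then obtain w where w: "z \<in> mspace Z" "w \<in> mspace Z" "t < h w" "mdist Z w z < e"
        by (auto simp: nbhd_def)
      have "h w \<le> h z + L * mdist Z w z" using L(2)[OF w(2,1)] by linarith
      also have "L * mdist Z w z \<le> L * e" using w L by (intro mult_left_mono) auto
      finally show "z \<in> {z \<in> space \<nu>. t < h z + L * e}" using w by (simp add: sp)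
    qed
    then have "measure \<nu> (nbhd Z e ?A) \<le> measure \<nu> {z \<in> space \<nu>. t < h z + L * e}"
      by (intro \<nu>.finite_measure_mono) measurable
    then have "measure \<mu> ?A \<le> measure \<nu> {z \<in> space \<nu>. t < h z + L * e} + e"
      using le[OF A] by linarith
    then have "emeasure \<mu> ?A \<le> emeasure \<nu> {z \<in> space \<nu>. t < h z + L * e} + ennreal e"
      using e by (simp add: \<mu>.emeasure_eq_measure \<nu>.emeasure_eq_measure flip: ennreal_plus)
    then show "emeasure \<mu> {z \<in> space \<mu>. t < h z} * indicator {0..1} t \<le>
        emeasure \<nu> {z \<in> space \<nu>. t < h z + L * e} * indicator {0..1} t + ennreal e * indicator {0..1} t"
      by (auto simp: indicator_def sp)
  qed
  also have "\<dots> = (\<integral>\<^sup>+t. emeasure \<nu> {z \<in> space \<nu>. t < h z + L * e} * indicator {0..1} t \<partial>lborel) + e"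
  proof (subst nn_integral_add)
    show "(\<lambda>t. emeasure \<nu> {z \<in> space \<nu>. t < h z + L * e} * indicator {0..1} t)
        \<in> borel_measurable lborel"
    proof -
      have "{p \<in> space (lborel \<Otimes>\<^sub>M \<nu>). fst p < h (snd p) + L * e} \<in> sets (lborel \<Otimes>\<^sub>M \<nu>)"
        by measurable
      from \<nu>.measurable_emeasure_Pair[OF this]
      have "(\<lambda>t. emeasure \<nu> {z \<in> space \<nu>. t < h z + L * e}) \<in> borel_measurable lborel"
        by (simp add: vimage_def space_pair_measure)
      then show ?thesis by measurable
    qed
  qed (auto simp: nn_integral_cmult_indicator)
  also have "(\<integral>\<^sup>+t. emeasure \<nu> {z \<in> space \<nu>. t < h z + L * e} * indicator {0..1} t \<partial>lborel) =
      (\<integral>\<^sup>+z. emeasure lborel {t. 0 \<le> t \<and> t \<le> 1 \<and> t < h z + L * e} \<partial>\<nu>)"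
    by (intro truncated_layer_cake[OF \<nu>(1)]) measurable
  also have "\<dots> \<le> (\<integral>\<^sup>+z. ennreal (h z + L * e) \<partial>\<nu>)"
  proof (rule nn_integral_mono)
    fix z assume z: "z \<in> space \<nu>"
    have "emeasure lborel {t. 0 \<le> t \<and> t \<le> 1 \<and> t < h z + L * e} \<le> emeasure lborel {0..<h z + L * e}"
      by (intro emeasure_mono) auto
    then show "emeasure lborel {t. 0 \<le> t \<and> t \<le> 1 \<and> t < h z + L * e} \<le> ennreal (h z + L * e)"
      using h[of z] z L e by (simp add: sp)
  qed
  also have "\<dots> = ennreal (\<integral>z. h z + L * e \<partial>\<nu>)"
    using h L e int by (intro nn_integral_eq_integral AE_I2) (auto simp: sp)
  also have "(\<integral>z. h z + L * e \<partial>\<nu>) = (\<integral>z. h z \<partial>\<nu>) + L * e"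
    using int by (simp add: \<nu>.prob_space)
  finally have "ennreal (\<integral>z. h z \<partial>\<mu>) \<le> ennreal ((\<integral>z. h z \<partial>\<nu>) + L * e) + ennreal e"
    by (simp add: add_mono)
  then have "ennreal (\<integral>z. h z \<partial>\<mu>) \<le> ennreal ((\<integral>z. h z \<partial>\<nu>) + L * e + e)"
    using e L nonneg by (simp flip: ennreal_plus)
  then show ?thesis
    using e L nonneg by (subst (asm) ennreal_le_iff) (auto simp: algebra_simps)
qed

text \<open>Induction on the index set: integrating out the last coordinate over \<open>X\<close> or over \<open>Y\<close>
  gives two functions of the other coordinates that differ by at most \<open>(L + 1) e\<close>, and both are
  again \<open>L\<close>-Lipschitz, so that the induction hypothesis applies.\<close>

lemma embedded_integral_close:
  fixes X :: "'a mm" and Y :: "'b mm" and F :: "('i \<Rightarrow> 'c) \<Rightarrow> real"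
    and L e :: real
  assumes X: "mm_space X" and Y: "mm_space Y"
    and f: "isometric_embedding (mm_metric X) Z f" and g: "isometric_embedding (mm_metric Y) Z g"
    and e: "0 < e"
    and le: "\<And>A. A \<in> sets (borel_of (mtopology_of Z)) \<Longrightarrow>
      measure (distr (mm_measure X) (borel_of (mtopology_of Z)) f) A \<le>
        measure (distr (mm_measure Y) (borel_of (mtopology_of Z)) g) (nbhd Z e A) + e \<and>
      measure (distr (mm_measure Y) (borel_of (mtopology_of Z)) g) A \<le>
        measure (distr (mm_measure X) (borel_of (mtopology_of Z)) f) (nbhd Z e A) + e"
    and J: "finite J" and F: "lip_on Z J L F"
    and F01: "\<And>z. z \<in> J \<rightarrow> mspace Z \<Longrightarrow> 0 \<le> F z \<and> F z \<le> 1"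
  shows "\<bar>(\<integral>x. F (\<lambda>i. f (x i)) \<partial>PiM J (\<lambda>_. mm_measure X)) -
      (\<integral>y. F (\<lambda>i. g (y i)) \<partial>PiM J (\<lambda>_. mm_measure Y))\<bar> \<le> card J * ((L + 1) * e)"
  using J F F01
proof (induction J arbitrary: F rule: finite_induct)
  case empty
  have "F (\<lambda>_. f undefined) = F (\<lambda>_. g undefined)"
    using empty(1) by (intro lip_on_cong[OF empty(1)]) auto
  then show ?case by (simp add: PiM_empty lebesgue_integral_count_space_finite)
next
  case (insert i J)
  let ?B = "borel_of (mtopology_of Z)"
  interpret \<mu>: prob_space "mm_measure X" by (rule mm_space_prob[OF X])
  interpret \<nu>: prob_space "mm_measure Y" by (rule mm_space_prob[OF Y])
  have mf: "f \<in> mm_measure X \<rightarrow>\<^sub>M ?B" and mg: "g \<in> mm_measure Y \<rightarrow>\<^sub>M ?B"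
    using f g X Y by (auto intro!: isometric_embedding_measurable simp: mm_space_def)
  have fZ: "f y \<in> mspace Z" if "y \<in> space (mm_measure X)" for y
    using f that by (auto simp: isometric_embedding_def mm_space_space[OF X])
  have gZ: "g y \<in> mspace Z" if "y \<in> space (mm_measure Y)" for y
    using g that by (auto simp: isometric_embedding_def mm_space_space[OF Y])
  have L: "0 \<le> L" using insert.prems(1) by (simp add: lip_on_def)
  define G where "G = (\<lambda>z. \<integral>y. F (z(i := f y)) \<partial>mm_measure X)"
  define H where "H = (\<lambda>z. \<integral>y. F (z(i := g y)) \<partial>mm_measure Y)"
  have absF: "\<bar>F z\<bar> \<le> 1" if "z \<in> insert i J \<rightarrow> mspace Z" for z
    using insert.prems(2)[OF that] by auto
  have intf: "integrable (mm_measure X) (\<lambda>y. F (z(i := f y)))" if "z \<in> J \<rightarrow> mspace Z" for z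
    by (rule lip_on_slice_integrable[OF X f insert(1,2) insert.prems(1) absF that])
  have intg: "integrable (mm_measure Y) (\<lambda>y. F (z(i := g y)))" if "z \<in> J \<rightarrow> mspace Z" for z
    by (rule lip_on_slice_integrable[OF Y g insert(1,2) insert.prems(1) absF that])
  have Glip: "lip_on Z J L G"
    unfolding G_def by (rule lip_on_integral[OF \<mu>.prob_space_axioms fZ insert(1,2) insert.prems(1) intf])
  have Hlip: "lip_on Z J L H"
    unfolding H_def by (rule lip_on_integral[OF \<nu>.prob_space_axioms gZ insert(1,2) insert.prems(1) intg])
  have G01: "0 \<le> G z \<and> G z \<le> 1" if z: "z \<in> J \<rightarrow> mspace Z" for z
  proof
    have *: "z(i := f y) \<in> insert i J \<rightarrow> mspace Z" if "y \<in> space (mm_measure X)" for y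
      using z fZ[OF that] by auto
    show "0 \<le> G z" unfolding G_def using insert.prems(2)[OF *] by (intro integral_nonneg_AE AE_I2) (simp del: fun_upd_apply)
    show "G z \<le> 1" unfolding G_def using insert.prems(2)[OF *] intf[OF z]
      by (intro \<mu>.integral_le_const AE_I2) (simp_all del: fun_upd_apply)
  qed
  have GH: "\<bar>G z - H z\<bar> \<le> (L + 1) * e" if z: "z \<in> J \<rightarrow> mspace Z" for z
  proof -
    define h where "h = (\<lambda>v. F (z(i := v)))"
    have hL: "\<bar>h u - h v\<bar> \<le> L * mdist Z u v" if "u \<in> mspace Z" "v \<in> mspace Z" for u v
      unfolding h_def using lip_on_slice[OF insert.prems(1) insert(2,1) z that] .
    have h01: "0 \<le> h v \<and> h v \<le> 1" if "v \<in> mspace Z" for v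
      unfolding h_def using z that by (intro insert.prems(2)) auto
    have hB: "h \<in> borel_measurable ?B" using hL by (rule lipschitz_measurable_borel_of)
    have G: "G z = (\<integral>v. h v \<partial>distr (mm_measure X) ?B f)"
      by (simp add: G_def h_def[symmetric] integral_distr[OF mf hB] ) (simp add: h_def)
    have H: "H z = (\<integral>v. h v \<partial>distr (mm_measure Y) ?B g)"
      by (simp add: H_def h_def[symmetric] integral_distr[OF mg hB] ) (simp add: h_def)
    have "G z \<le> H z + (L + 1) * e"
      unfolding G H using le hL h01 L e
      by (intro prohorov_integral_le[where Z = Z]) (auto intro: \<mu>.prob_space_distr mf \<nu>.prob_space_distr mg)
    moreover have "H z \<le> G z + (L + 1) * e"
      unfolding G H using le hL h01 L e
      by (intro prohorov_integral_le[where Z = Z]) (auto intro: \<mu>.prob_space_distr mf \<nu>.prob_space_distr mg)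
    ultimately show ?thesis by linarith
  qed
  have upd: "(\<lambda>k. h ((x(i := y)) k)) = (\<lambda>k. h (x k))(i := h y)" for h :: "'z \<Rightarrow> 'c" and x y
    by auto
  have fJ: "(\<lambda>k. f (x k)) \<in> J' \<rightarrow> mspace Z" if "x \<in> J' \<rightarrow> mspace (mm_metric X)" for x and J' :: "'i set"
    using that f by (auto simp: isometric_embedding_def Pi_iff)
  have gJ: "(\<lambda>k. g (x k)) \<in> J' \<rightarrow> mspace Z" if "x \<in> J' \<rightarrow> mspace (mm_metric Y)" for x and J' :: "'i set"
    using that g by (auto simp: isometric_embedding_def Pi_iff)
  have absG: "\<bar>G z\<bar> \<le> 1" if "z \<in> J \<rightarrow> mspace Z" for z using G01[OF that] by auto
  have absH: "\<bar>H z\<bar> \<le> 1 + (L + 1) * e" if "z \<in> J \<rightarrow> mspace Z" for z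
    using GH[OF that] absG[OF that] by linarith
  have X_eq: "(\<integral>x. F (\<lambda>k. f (x k)) \<partial>PiM (insert i J) (\<lambda>_. mm_measure X)) =
      (\<integral>x. G (\<lambda>k. f (x k)) \<partial>PiM J (\<lambda>_. mm_measure X))"
    unfolding G_def
    by (subst lip_on_integral_insert[OF X insert(1,2) lip_on_compose_isometry[OF insert.prems(1) f],
          where B = 1]) (auto simp only: upd intro!: absF fJ)
  have Y_eq: "(\<integral>x. F (\<lambda>k. g (x k)) \<partial>PiM (insert i J) (\<lambda>_. mm_measure Y)) =
      (\<integral>x. H (\<lambda>k. g (x k)) \<partial>PiM J (\<lambda>_. mm_measure Y))"
    unfolding H_def
    by (subst lip_on_integral_insert[OF Y insert(1,2) lip_on_compose_isometry[OF insert.prems(1) g],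
          where B = 1]) (auto simp only: upd intro!: absF gJ)
  interpret PY: prob_space "PiM J (\<lambda>_. mm_measure Y)" by (rule prob_space_PiM_mm[OF Y])
  have iG: "integrable (PiM J (\<lambda>_. mm_measure Y)) (\<lambda>x. G (\<lambda>k. g (x k)))"
    by (rule lip_on_integrable[OF Y insert(1) lip_on_compose_isometry[OF Glip g] absG[OF gJ]])
  have iH: "integrable (PiM J (\<lambda>_. mm_measure Y)) (\<lambda>x. H (\<lambda>k. g (x k)))"
    by (rule lip_on_integrable[OF Y insert(1) lip_on_compose_isometry[OF Hlip g] absH[OF gJ]])
  have "\<bar>(\<integral>x. G (\<lambda>k. g (x k)) \<partial>PiM J (\<lambda>_. mm_measure Y)) -
      (\<integral>x. H (\<lambda>k. g (x k)) \<partial>PiM J (\<lambda>_. mm_measure Y))\<bar> =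
      \<bar>\<integral>x. G (\<lambda>k. g (x k)) - H (\<lambda>k. g (x k)) \<partial>PiM J (\<lambda>_. mm_measure Y)\<bar>"
    using iG iH by simp
  also have "\<dots> \<le> (\<integral>x. \<bar>G (\<lambda>k. g (x k)) - H (\<lambda>k. g (x k))\<bar> \<partial>PiM J (\<lambda>_. mm_measure Y))"
    by (rule integral_abs_bound)
  also have "\<dots> \<le> (L + 1) * e"
    using iG iH GH gJ by (intro PY.integral_le_const AE_I2) (auto simp: space_PiM_mm[OF Y] PiE_def)
  finally have 2: "\<bar>(\<integral>x. G (\<lambda>k. g (x k)) \<partial>PiM J (\<lambda>_. mm_measure Y)) -
      (\<integral>x. H (\<lambda>k. g (x k)) \<partial>PiM J (\<lambda>_. mm_measure Y))\<bar> \<le> (L + 1) * e" .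
  have 1: "\<bar>(\<integral>x. G (\<lambda>i. f (x i)) \<partial>PiM J (\<lambda>_. mm_measure X)) -
      (\<integral>y. G (\<lambda>i. g (y i)) \<partial>PiM J (\<lambda>_. mm_measure Y))\<bar> \<le> card J * ((L + 1) * e)"
    using Glip G01 by (rule insert.IH)
  have "real (card (insert i J)) * ((L + 1) * e) = card J * ((L + 1) * e) + (L + 1) * e"
    using insert(1,2) by (simp add: algebra_simps)
  then show ?case unfolding X_eq Y_eq using 1 2 by linarith
qed

text \<open>The integrand of \<open>\<chi>\<^sub>A\<close>, for an arbitrary set \<open>S\<close> of index pairs in place of \<open>index_pairs n\<close>.\<close>

definition pair_exp :: "'c metric \<Rightarrow> ('i \<times> 'i) set \<Rightarrow> ('i \<times> 'i \<Rightarrow> real) \<Rightarrow> ('i \<Rightarrow> 'c) \<Rightarrow> real" where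
  "pair_exp Z S a x = exp (- (\<Sum>(i, j)\<in>S. a (i, j) * mdist Z (x i) (x j)))"

lemma exp_minus_diff_le: "\<bar>exp (- s) - exp (- t)\<bar> \<le> \<bar>s - t\<bar>" if "0 \<le> s" "0 \<le> t" for s t :: real
proof -
  have *: "exp (- s) - exp (- t) \<le> t - s" if "0 \<le> s" "s \<le> t" for s t :: real
  proof -
    have "exp (- s) - exp (- t) = exp (- s) * (1 - exp (- (t - s)))"
      by (simp add: algebra_simps flip: exp_add)
    also have "\<dots> \<le> 1 * (1 - exp (- (t - s)))" using that by (intro mult_right_mono) auto
    also have "\<dots> \<le> t - s" using exp_ge_add_one_self[of "- (t - s)"] unfolding mult_1 by linarith
    finally show ?thesis .
  qed
  show ?thesis using *[of s t] *[of t s] that by (cases "s \<le> t") auto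
qed

lemma mdist_diff_le:
  assumes "u \<in> mspace Z" "v \<in> mspace Z" "u' \<in> mspace Z" "v' \<in> mspace Z"
  shows "\<bar>mdist Z u v - mdist Z u' v'\<bar> \<le> mdist Z u u' + mdist Z v v'"
proof -
  have "mdist Z u v \<le> mdist Z u u' + mdist Z u' v' + mdist Z v v'"
    using mdist_triangle[of u Z u' v] mdist_triangle[of u' Z v' v] assms by (simp add: mdist_commute)
  moreover have "mdist Z u' v' \<le> mdist Z u u' + mdist Z u v + mdist Z v v'"
    using mdist_triangle[of u' Z u v'] mdist_triangle[of u Z v v'] assms by (simp add: mdist_commute)
  ultimately show ?thesis by linarith
qed

lemma pair_exp_bounds:
  assumes "\<And>p. p \<in> S \<Longrightarrow> 0 \<le> a p"
  shows "0 \<le> pair_exp Z S a x" "pair_exp Z S a x \<le> 1"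
  using assms by (auto simp: pair_exp_def intro!: sum_nonneg)

lemma pair_exp_lip_on:
  assumes S: "S \<subseteq> J \<times> J" and J: "finite J" and a: "\<And>p. p \<in> S \<Longrightarrow> 0 \<le> a p"
  shows "lip_on Z J (2 * sum a S) (pair_exp Z S a)"
  unfolding lip_on_def
proof (intro conjI ballI)
  show "0 \<le> 2 * sum a S" using a by (simp add: sum_nonneg)
  fix z w assume z: "z \<in> J \<rightarrow> mspace Z" and w: "w \<in> J \<rightarrow> mspace Z"
  let ?D = "\<Sum>i\<in>J. mdist Z (z i) (w i)"
  have "\<bar>pair_exp Z S a z - pair_exp Z S a w\<bar> \<le>
      \<bar>(\<Sum>(i, j)\<in>S. a (i, j) * mdist Z (z i) (z j)) - (\<Sum>(i, j)\<in>S. a (i, j) * mdist Z (w i) (w j))\<bar>"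
    unfolding pair_exp_def using a by (intro exp_minus_diff_le sum_nonneg) auto
  also have "\<dots> = \<bar>\<Sum>(i, j)\<in>S. a (i, j) * (mdist Z (z i) (z j) - mdist Z (w i) (w j))\<bar>"
    by (simp add: sum_subtractf[symmetric] algebra_simps case_prod_beta)
  also have "\<dots> \<le> (\<Sum>(i, j)\<in>S. a (i, j) * (2 * ?D))"
  proof (rule order_trans[OF sum_abs], rule sum_mono, clarify)
    fix i j assume ij: "(i, j) \<in> S"
    then have ijJ: "i \<in> J" "j \<in> J" using S by auto
    have "\<bar>mdist Z (z i) (z j) - mdist Z (w i) (w j)\<bar> \<le> mdist Z (z i) (w i) + mdist Z (z j) (w j)"
      using z w ijJ by (intro mdist_diff_le) auto
    also have "\<dots> \<le> 2 * ?D"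
      using member_le_sum[OF ijJ(1), of "\<lambda>i. mdist Z (z i) (w i)"]
        member_le_sum[OF ijJ(2), of "\<lambda>i. mdist Z (z i) (w i)"] J by auto
    finally show "\<bar>a (i, j) * (mdist Z (z i) (z j) - mdist Z (w i) (w j))\<bar> \<le> a (i, j) * (2 * ?D)"
      using a[OF ij] by (simp add: abs_mult mult_left_mono)
  qed
  also have "\<dots> = 2 * sum a S * ?D"
    by (simp add: sum_distrib_right sum_distrib_left case_prod_beta mult_ac)
  finally show "\<bar>pair_exp Z S a z - pair_exp Z S a w\<bar> \<le> 2 * sum a S * ?D" .
qed

lemma finite_index_pairs: "finite (index_pairs n)"
  by (rule finite_subset[of _ "{1..n} \<times> {1..n}"]) (auto simp: index_pairs_def)

lemma index_pairs_subset: "index_pairs n \<subseteq> {1..n} \<times> {1..n}"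
  by (auto simp: index_pairs_def)

lemma chi_eq_pair_exp:
  "chi (Array n a) X =
    (\<integral>x. pair_exp (mm_metric X) (index_pairs n) a x \<partial>PiM {1..n} (\<lambda>_. mm_measure X))"
  by (simp add: pair_exp_def)

lemma chi_close:
  fixes X :: "'a mm" and Y :: "'b mm"
  assumes X: "mm_space X" and Y: "mm_space Y"
    and f: "isometric_embedding (mm_metric X) Z f" and g: "isometric_embedding (mm_metric Y) Z g"
    and less: "embedded_prohorov X Y Z f g < e" and a: "\<And>p. p \<in> index_pairs n \<Longrightarrow> 0 \<le> a p"
  shows "\<bar>chi (Array n a) X - chi (Array n a) Y\<bar> \<le> n * ((2 * sum a (index_pairs n) + 1) * e)"
proof -
  let ?B = "borel_of (mtopology_of Z)"
  let ?P = "distr (mm_measure X) ?B f" and ?Q = "distr (mm_measure Y) ?B g"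
  let ?E = "{e. 0 < e \<and> (\<forall>A \<in> sets ?B. measure ?P A \<le> measure ?Q (nbhd Z e A) + e \<and>
                measure ?Q A \<le> measure ?P (nbhd Z e A) + e)}"
  have mf: "f \<in> mm_measure X \<rightarrow>\<^sub>M ?B" and mg: "g \<in> mm_measure Y \<rightarrow>\<^sub>M ?B"
    using f g X Y by (auto intro!: isometric_embedding_measurable simp: mm_space_def)
  have "prob_space ?P" "prob_space ?Q"
    using mf mg X Y by (auto intro!: prob_space.prob_space_distr mm_space_prob)
  then have "?E \<noteq> {}" using prohorov_dist_prob(2) by blast
  moreover have "Inf ?E < e" using less by (simp add: embedded_prohorov_def prohorov_dist_def)
  ultimately obtain e' where e': "e' \<in> ?E" "e' < e" by (rule cInf_lessD[THEN bexE])
  let ?F = "pair_exp Z (index_pairs n) a" and ?L = "2 * sum a (index_pairs n)"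
  have L: "0 \<le> ?L" using a by (simp add: sum_nonneg)
  have "\<bar>(\<integral>x. ?F (\<lambda>i. f (x i)) \<partial>PiM {1..n} (\<lambda>_. mm_measure X)) -
      (\<integral>y. ?F (\<lambda>i. g (y i)) \<partial>PiM {1..n} (\<lambda>_. mm_measure Y))\<bar> \<le> card {1..n} * ((?L + 1) * e')"
    using e' a pair_exp_bounds[OF a]
    by (intro embedded_integral_close[OF X Y f g] pair_exp_lip_on index_pairs_subset) auto
  also have "\<dots> \<le> n * ((?L + 1) * e)" using e' L by (auto intro!: mult_left_mono)
  also have "(\<integral>x. ?F (\<lambda>i. f (x i)) \<partial>PiM {1..n} (\<lambda>_. mm_measure X)) = chi (Array n a) X"
    unfolding chi_eq_pair_exp
  proof (intro Bochner_Integration.integral_cong refl)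
    fix x assume "x \<in> space (PiM {1..n} (\<lambda>_. mm_measure X))"
    then have "x i \<in> mspace (mm_metric X)" if "i \<in> {1..n}" for i
      using that by (auto simp: space_PiM_mm[OF X])
    then show "?F (\<lambda>i. f (x i)) = pair_exp (mm_metric X) (index_pairs n) a x"
      using f index_pairs_subset[of n] unfolding pair_exp_def isometric_embedding_def
      by (intro arg_cong[where f = "\<lambda>s. exp (- s)"] sum.cong) auto
  qed
  also have "(\<integral>x. ?F (\<lambda>i. g (x i)) \<partial>PiM {1..n} (\<lambda>_. mm_measure Y)) = chi (Array n a) Y"
    unfolding chi_eq_pair_exp
  proof (intro Bochner_Integration.integral_cong refl)
    fix x assume "x \<in> space (PiM {1..n} (\<lambda>_. mm_measure Y))"
    then have "x i \<in> mspace (mm_metric Y)" if "i \<in> {1..n}" for i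
      using that by (auto simp: space_PiM_mm[OF Y])
    then show "?F (\<lambda>i. g (x i)) = pair_exp (mm_metric Y) (index_pairs n) a x"
      using g index_pairs_subset[of n] unfolding pair_exp_def isometric_embedding_def
      by (intro arg_cong[where f = "\<lambda>s. exp (- s)"] sum.cong) auto
  qed
  finally show ?thesis .
qed

section \<open>Gluing along finite nets\<close>

text \<open>The two nets are joined by bridges of length \<open>\<delta>\<close>: the distance between points of different
  spaces is the length of the shortest way over a bridge. Going over one bridge and back over
  another one yields no shortcut, since the bridges cost \<open>2 \<delta>\<close> together and mutual distances in the
  two nets differ by no more than that.\<close>

lemma glued_metric:
  fixes A :: "'a metric" and B :: "'b metric"
  assumes I: "finite I" "I \<noteq> {}" and x: "\<And>i. i \<in> I \<Longrightarrow> x i \<in> mspace A"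
    and y: "\<And>i. i \<in> I \<Longrightarrow> y i \<in> mspace B" and \<delta>: "0 < \<delta>"
    and near: "\<And>i j. i \<in> I \<Longrightarrow> j \<in> I \<Longrightarrow>
      \<bar>mdist A (x i) (x j) - mdist B (y i) (y j)\<bar> \<le> 2 * \<delta>"
  obtains Z :: "('a + 'b) metric"
  where "isometric_embedding A Z Inl" "isometric_embedding B Z Inr"
    "\<And>u v i. u \<in> mspace A \<Longrightarrow> v \<in> mspace B \<Longrightarrow> i \<in> I \<Longrightarrow>
      mdist Z (Inl u) (Inr v) \<le> mdist A u (x i) + \<delta> + mdist B (y i) v"
proof -
  define cr where "cr = (\<lambda>u v. Min ((\<lambda>i. mdist A u (x i) + \<delta> + mdist B (y i) v) ` I))"
  have cr_le: "cr u v \<le> mdist A u (x i) + \<delta> + mdist B (y i) v" if "i \<in> I" for u v i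
    unfolding cr_def using I that by (intro Min_le) auto
  have cr_attained: "\<exists>i\<in>I. cr u v = mdist A u (x i) + \<delta> + mdist B (y i) v" for u v
  proof -
    have "cr u v \<in> (\<lambda>i. mdist A u (x i) + \<delta> + mdist B (y i) v) ` I"
      unfolding cr_def using I by (intro Min_in) auto
    then show ?thesis by auto
  qed
  have cr_pos: "0 < cr u v" for u v
  proof -
    obtain i where "cr u v = mdist A u (x i) + \<delta> + mdist B (y i) v" using cr_attained by blast
    then show ?thesis using \<delta> mdist_nonneg[of A u "x i"] mdist_nonneg[of B "y i" v] by linarith
  qed
  have tri1: "cr u v \<le> mdist A u u' + cr u' v" if "u \<in> mspace A" "u' \<in> mspace A" for u u' v
  proof -
    obtain i where "i \<in> I" "cr u' v = mdist A u' (x i) + \<delta> + mdist B (y i) v"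
      using cr_attained by blast
    then show ?thesis using cr_le[of i u v] mdist_triangle[OF that x[of i]] by linarith
  qed
  have tri2: "cr u v \<le> cr u v' + mdist B v' v" if "v \<in> mspace B" "v' \<in> mspace B" for u v v'
  proof -
    obtain i where "i \<in> I" "cr u v' = mdist A u (x i) + \<delta> + mdist B (y i) v'"
      using cr_attained by blast
    then show ?thesis using cr_le[of i u v] mdist_triangle[OF y[of i] that(2,1)] by linarith
  qed
  have tri1': "cr u v \<le> cr u' v + mdist A u' u" if "u \<in> mspace A" "u' \<in> mspace A" for u u' v
    using tri1[OF that] by (simp add: mdist_commute add.commute)
  have tri2': "cr u v \<le> mdist B v v' + cr u v'" if "v \<in> mspace B" "v' \<in> mspace B" for u v v'
    using tri2[OF that] by (simp add: mdist_commute add.commute)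
  have tri3: "mdist A u u' \<le> cr u v + cr u' v"
    if "u \<in> mspace A" "u' \<in> mspace A" "v \<in> mspace B" for u u' v
  proof -
    obtain i where i: "i \<in> I" "cr u v = mdist A u (x i) + \<delta> + mdist B (y i) v"
      using cr_attained by blast
    obtain j where j: "j \<in> I" "cr u' v = mdist A u' (x j) + \<delta> + mdist B (y j) v"
      using cr_attained by blast
    have "mdist A u u' \<le> mdist A u (x i) + mdist A (x i) (x j) + mdist A u' (x j)"
      using mdist_triangle[OF that(1) x[OF i(1)] that(2)]
        mdist_triangle[OF x[OF i(1)] x[OF j(1)] that(2)] mdist_commute[of A "x j" u'] by linarith
    moreover have "mdist B (y i) (y j) \<le> mdist B (y i) v + mdist B (y j) v"
      using mdist_triangle[OF y[OF i(1)] that(3) y[OF j(1)]] mdist_commute[of B v "y j"] by linarith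
    ultimately show ?thesis using near[OF i(1) j(1)] i(2) j(2) by linarith
  qed
  have tri4: "mdist B v v' \<le> cr u v + cr u v'"
    if "u \<in> mspace A" "v \<in> mspace B" "v' \<in> mspace B" for u v v'
  proof -
    obtain i where i: "i \<in> I" "cr u v = mdist A u (x i) + \<delta> + mdist B (y i) v"
      using cr_attained by blast
    obtain j where j: "j \<in> I" "cr u v' = mdist A u (x j) + \<delta> + mdist B (y j) v'"
      using cr_attained by blast
    have "mdist B v v' \<le> mdist B (y i) v + mdist B (y i) (y j) + mdist B (y j) v'"
      using mdist_triangle[OF that(2) y[OF i(1)] that(3)] mdist_commute[of B v "y i"]
        mdist_triangle[OF y[OF i(1)] y[OF j(1)] that(3)] by linarith
    moreover have "mdist A (x i) (x j) \<le> mdist A u (x i) + mdist A u (x j)"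
      using mdist_triangle[OF x[OF i(1)] that(1) x[OF j(1)]] mdist_commute[of A "x i" u] by linarith
    ultimately show ?thesis using near[OF i(1) j(1)] i(2) j(2) by linarith
  qed
  define D where "D = (\<lambda>p q. case p of
      Inl u \<Rightarrow> (case q of Inl u' \<Rightarrow> mdist A u u' | Inr v \<Rightarrow> cr u v)
    | Inr v \<Rightarrow> (case q of Inl u \<Rightarrow> cr u v | Inr v' \<Rightarrow> mdist B v v'))"
  have D: "Metric_space (mspace A <+> mspace B) D"
  proof
    show "0 \<le> D p q" for p q
      by (auto simp: D_def less_imp_le cr_pos split: sum.split)
    show "D p q = D q p" for p q
      by (auto simp: D_def mdist_commute split: sum.split)
    show "(D p q = 0) = (p = q)" if "p \<in> mspace A <+> mspace B" "q \<in> mspace A <+> mspace B" for p q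
      using that cr_pos less_irrefl by (auto simp: D_def split: sum.split) (metis less_irrefl)+
    show "D p r \<le> D p q + D q r" if "p \<in> mspace A <+> mspace B" "q \<in> mspace A <+> mspace B"
      "r \<in> mspace A <+> mspace B" for p q r
      using that
      by (auto simp: D_def mdist_triangle split: sum.split intro: tri1 tri1' tri2 tri2' tri3 tri4)
  qed
  define Z where "Z = metric (mspace A <+> mspace B, D)"
  have Z: "mspace Z = mspace A <+> mspace B" "mdist Z = D"
    unfolding Z_def using D by (simp_all add: Metric_space.mspace_metric Metric_space.mdist_metric)
  show thesis
  proof (rule that)
    show "isometric_embedding A Z Inl" "isometric_embedding B Z Inr"
      by (auto simp: isometric_embedding_def Z D_def)
  qed (auto simp: Z D_def cr_le)
qed

text \<open>The condition on \<open>A\<close> with the two measures exchanged is the given condition on the complement of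
  the neighbourhood of \<open>A\<close>, whose own neighbourhood does not meet \<open>A\<close>.\<close>

lemma prohorov_dist_le_one_sided:
  assumes P: "prob_space P" "sets P = sets (borel_of (mtopology_of Z))"
    and Q: "prob_space Q" "sets Q = sets (borel_of (mtopology_of Z))" and e: "0 < e"
    and le: "\<And>A. A \<in> sets (borel_of (mtopology_of Z)) \<Longrightarrow> measure Q A \<le> measure P (nbhd Z e A) + e"
  shows "prohorov_dist Z P Q \<le> e"
proof -
  interpret P: prob_space P by fact
  interpret Q: prob_space Q by fact
  have sp: "space P = mspace Z" "space Q = mspace Z"
    using sets_eq_imp_space_eq[OF P(2)] sets_eq_imp_space_eq[OF Q(2)] by simp_all
  have "measure P A \<le> measure Q (nbhd Z e A) + e" if A: "A \<in> sets (borel_of (mtopology_of Z))" for A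
  proof -
    define B where "B = mspace Z - nbhd Z e A"
    have nA: "nbhd Z e A \<in> sets Q" using nbhd_sets[OF A] Q by simp
    have AZ: "A \<subseteq> mspace Z" using sets.sets_into_space[OF A] by simp
    have B: "B \<in> sets (borel_of (mtopology_of Z))"
      using sets.compl_sets[OF nA] Q sp by (simp add: B_def)
    have "nbhd Z e B \<subseteq> space P - A"
      using AZ by (auto simp: B_def nbhd_def sp) (metis mdist_commute)
    then have "measure P (nbhd Z e B) \<le> measure P (space P - A)"
      using A P by (intro P.finite_measure_mono) auto
    also have "\<dots> = 1 - measure P A" using A P by (intro P.prob_compl) simp
    finally have "measure Q B \<le> 1 - measure P A + e" using le[OF B] by linarith
    moreover have "measure Q B = 1 - measure Q (nbhd Z e A)"
      using Q.prob_compl[OF nA] by (simp add: B_def sp)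
    ultimately show ?thesis by linarith
  qed
  then show ?thesis
    unfolding prohorov_dist_def using le e by (intro cInf_lower) (auto intro!: bdd_belowI[of _ 0])
qed

definition ball_union :: "'c mm \<Rightarrow> 'i set \<Rightarrow> ('i \<Rightarrow> 'c) \<Rightarrow> real \<Rightarrow> 'c set" where
  "ball_union W I w r = (\<Union>i\<in>I. {u \<in> mspace (mm_metric W). mdist (mm_metric W) (w i) u < r})"

lemma ball_union_sets:
  assumes "mm_space W" "finite I" "\<And>i. i \<in> I \<Longrightarrow> w i \<in> mspace (mm_metric W)"
  shows "ball_union W I w r \<in> sets (mm_measure W)"
  unfolding ball_union_def using assms by (intro sets.finite_UN mm_space_ball_sets) auto

text \<open>Given a set \<open>E\<close> in the glued space, let \<open>J\<close> consist of the indices whose \<open>\<delta>\<close>-ball meets \<open>E\<close>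
  in \<open>Y\<close>. Up to mass \<open>\<delta>\<close> the part of \<open>E\<close> in \<open>Y\<close> is covered by these balls, and every point in the
  corresponding \<open>2 \<delta>\<close>-balls of \<open>X\<close> is within \<open>2 \<delta> + \<delta> + \<delta>\<close> of \<open>E\<close>.\<close>

lemma gromov_prohorov_le_of_nets:
  fixes X :: "'a mm" and Y :: "'b mm"
  assumes X: "mm_space X" and Y: "mm_space Y" and I: "finite I" "I \<noteq> {}"
    and x: "\<And>i. i \<in> I \<Longrightarrow> x i \<in> mspace (mm_metric X)"
    and y: "\<And>i. i \<in> I \<Longrightarrow> y i \<in> mspace (mm_metric Y)" and \<delta>: "0 < \<delta>"
    and near: "\<And>i j. i \<in> I \<Longrightarrow> j \<in> I \<Longrightarrow>
      \<bar>mdist (mm_metric X) (x i) (x j) - mdist (mm_metric Y) (y i) (y j)\<bar> \<le> 2 * \<delta>"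
    and cover: "1 - \<delta> \<le> measure (mm_measure Y) (ball_union Y I y \<delta>)"
    and le: "\<And>J. J \<subseteq> I \<Longrightarrow> measure (mm_measure Y) (ball_union Y J y \<delta>) \<le>
      measure (mm_measure X) (ball_union X J x (2 * \<delta>)) + \<delta>"
  shows "gromov_prohorov X Y \<le> 4 * \<delta>"
proof -
  let ?A = "mm_metric X" and ?B = "mm_metric Y"
  obtain Z :: "('a + 'b) metric" where f: "isometric_embedding ?A Z Inl"
    and g: "isometric_embedding ?B Z Inr"
    and Z: "\<And>u v i. u \<in> mspace ?A \<Longrightarrow> v \<in> mspace ?B \<Longrightarrow> i \<in> I \<Longrightarrow>
      mdist Z (Inl u) (Inr v) \<le> mdist ?A u (x i) + \<delta> + mdist ?B (y i) v"
    by (rule glued_metric[of I x ?A y ?B \<delta>]) (use I x y \<delta> near that in blast)+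
  let ?S = "borel_of (mtopology_of Z)"
  interpret \<mu>: prob_space "mm_measure X" by (rule mm_space_prob[OF X])
  interpret \<nu>: prob_space "mm_measure Y" by (rule mm_space_prob[OF Y])
  have mf: "Inl \<in> mm_measure X \<rightarrow>\<^sub>M ?S" and mg: "Inr \<in> mm_measure Y \<rightarrow>\<^sub>M ?S"
    using f g X Y by (auto intro!: isometric_embedding_measurable simp: mm_space_def)
  have inl: "Inl u \<in> mspace Z" if "u \<in> mspace ?A" for u
    using f that by (auto simp: isometric_embedding_def)
  have inr: "Inr v \<in> mspace Z" if "v \<in> mspace ?B" for v
    using g that by (auto simp: isometric_embedding_def)
  have "prohorov_dist Z (distr (mm_measure X) ?S Inl) (distr (mm_measure Y) ?S Inr) \<le> 4 * \<delta>"
  proof (rule prohorov_dist_le_one_sided)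
    fix E assume E: "E \<in> sets ?S"
    let ?E = "Inr -` E \<inter> space (mm_measure Y)"
    have E': "?E \<in> sets (mm_measure Y)" using measurable_sets[OF mg E] .
    define J where "J = {i \<in> I. \<exists>v\<in>?E. mdist ?B (y i) v < \<delta>}"
    have J: "J \<subseteq> I" "finite J" using I by (auto simp: J_def)
    have bs: "ball_union Y J y \<delta> \<in> sets (mm_measure Y)" "ball_union Y I y \<delta> \<in> sets (mm_measure Y)"
      "ball_union X J x (2 * \<delta>) \<in> sets (mm_measure X)"
      using J I x y by (auto intro!: ball_union_sets X Y)
    have sub: "?E \<subseteq> ball_union Y J y \<delta> \<union> (space (mm_measure Y) - ball_union Y I y \<delta>)"
      by (auto simp: J_def ball_union_def mm_space_space[OF Y])
    have "measure (mm_measure Y) ?E \<le>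
        measure (mm_measure Y) (ball_union Y J y \<delta>) +
        measure (mm_measure Y) (space (mm_measure Y) - ball_union Y I y \<delta>)"
      using sub bs by (intro order_trans[OF \<nu>.finite_measure_mono measure_Un_le]) auto
    also have "measure (mm_measure Y) (space (mm_measure Y) - ball_union Y I y \<delta>) \<le> \<delta>"
      using cover \<nu>.prob_compl[OF bs(2)] by linarith
    also have "measure (mm_measure Y) (ball_union Y J y \<delta>) \<le>
        measure (mm_measure X) (ball_union X J x (2 * \<delta>)) + \<delta>"
      using J by (intro le)
    also have "measure (mm_measure X) (ball_union X J x (2 * \<delta>)) \<le>
        measure (mm_measure X) (Inl -` nbhd Z (4 * \<delta>) E \<inter> space (mm_measure X))"
    proof (rule \<mu>.finite_measure_mono)
      show "ball_union X J x (2 * \<delta>) \<subseteq> Inl -` nbhd Z (4 * \<delta>) E \<inter> space (mm_measure X)"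
      proof
        fix u assume "u \<in> ball_union X J x (2 * \<delta>)"
        then obtain i v where u: "u \<in> mspace ?A" "i \<in> I" "mdist ?A (x i) u < 2 * \<delta>"
          and v: "v \<in> ?E" "mdist ?B (y i) v < \<delta>"
          by (auto simp: ball_union_def J_def)
        have vB: "v \<in> mspace ?B" using v by (simp add: mm_space_space[OF Y])
        have "mdist Z (Inr v) (Inl u) < 4 * \<delta>"
          using Z[OF u(1) vB u(2)] u(3) v(2) by (simp add: mdist_commute)
        then show "u \<in> Inl -` nbhd Z (4 * \<delta>) E \<inter> space (mm_measure X)"
          using u v inl by (auto simp: nbhd_def mm_space_space[OF X])
      qed
    qed (rule measurable_sets[OF mf nbhd_sets[OF E]])
    finally have "measure (mm_measure Y) ?E \<le>
        measure (mm_measure X) (Inl -` nbhd Z (4 * \<delta>) E \<inter> space (mm_measure X)) + 4 * \<delta>"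
      using \<delta> by linarith
    then show "measure (distr (mm_measure Y) ?S Inr) E \<le>
        measure (distr (mm_measure X) ?S Inl) (nbhd Z (4 * \<delta>) E) + 4 * \<delta>"
      by (simp add: measure_distr[OF mg E] measure_distr[OF mf nbhd_sets[OF E]])
  qed (use \<delta> mf mg \<mu>.prob_space_distr \<nu>.prob_space_distr in auto)
  then have "embedded_prohorov X Y Z Inl Inr \<le> 4 * \<delta>" by (simp add: embedded_prohorov_def)
  with gromov_prohorov_le[OF X Y f g] show ?thesis by linarith
qed

text \<open>Ensures that the infimum defining \<open>gromov_prohorov\<close> is not over the empty set, for which
  \<open>Inf\<close> on the reals is unspecified. The two spaces are glued at one point each.\<close>

lemma joint_embedding_exists:
  fixes X :: "'a mm" and Y :: "'b mm"
  assumes X: "mm_space X" and Y: "mm_space Y"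
  shows "\<exists>(Z :: ('a + 'b) metric) f g.
    isometric_embedding (mm_metric X) Z f \<and> isometric_embedding (mm_metric Y) Z g"
proof -
  obtain x y where xy: "x \<in> mspace (mm_metric X)" "y \<in> mspace (mm_metric Y)"
    using prob_space.not_empty[OF mm_space_prob[OF X]] prob_space.not_empty[OF mm_space_prob[OF Y]]
    by (auto simp: mm_space_space X Y)
  have "mdist (mm_metric X) x x = 0" "mdist (mm_metric Y) y y = 0"
    using xy by simp_all
  then have zero: "\<bar>mdist (mm_metric X) x x - mdist (mm_metric Y) y y\<bar> \<le> 2" by linarith
  obtain Z :: "('a + 'b) metric" where "isometric_embedding (mm_metric X) Z Inl"
    "isometric_embedding (mm_metric Y) Z Inr"
    by (rule glued_metric[of "{()}" "\<lambda>_. x" "mm_metric X" "\<lambda>_. y" "mm_metric Y" 1])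
      (use xy zero that in simp_all)
  then show ?thesis by blast
qed

lemma gromov_prohorov_nonneg:
  assumes X: "mm_space X" and Y: "mm_space Y"
  shows "0 \<le> gromov_prohorov X Y"
  unfolding gromov_prohorov_def
  using joint_embedding_exists[OF X Y] embedded_prohorov_nonneg[OF X Y]
  by (intro cInf_greatest) blast+

lemma gromov_prohorov_lessE:
  fixes X :: "'a mm" and Y :: "'b mm"
  assumes X: "mm_space X" and Y: "mm_space Y" and less: "gromov_prohorov X Y < e"
  obtains Z :: "('a + 'b) metric" and f g where "isometric_embedding (mm_metric X) Z f"
    "isometric_embedding (mm_metric Y) Z g" "embedded_prohorov X Y Z f g < e"
proof -
  have "\<exists>r\<in>{embedded_prohorov X Y Z f g | (Z :: ('a + 'b) metric) f g.
            isometric_embedding (mm_metric X) Z f \<and> isometric_embedding (mm_metric Y) Z g}. r < e"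
    using joint_embedding_exists[OF X Y] less unfolding gromov_prohorov_def
    by (intro cInf_lessD) blast+
  then show thesis using that by blast
qed

lemma gromov_prohorov_imp_chi:
  fixes X :: "nat \<Rightarrow> 'a mm" and Y :: "'b mm"
  assumes X: "\<And>n. mm_space (X n)" and Y: "mm_space Y"
    and lim: "(\<lambda>n. gromov_prohorov (X n) Y) \<longlonglongrightarrow> 0" and A: "A \<in> arrays"
  shows "(\<lambda>n. chi A (X n)) \<longlonglongrightarrow> chi A Y"
proof (cases A)
  case (Array k a)
  then have a: "0 \<le> a p" if "p \<in> index_pairs k" for p
    using A that by (auto simp: arrays_def PiE_def Pi_iff)
  define c where "c = k * (2 * sum a (index_pairs k) + 1)"
  have bound: "norm (chi A (X n) - chi A Y) \<le> c * (gromov_prohorov (X n) Y + 1 / real (Suc n))" for n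
  proof -
    have "gromov_prohorov (X n) Y < gromov_prohorov (X n) Y + 1 / real (Suc n)" by simp
    then obtain Z :: "('a + 'b) metric" and f g where "isometric_embedding (mm_metric (X n)) Z f"
      "isometric_embedding (mm_metric Y) Z g"
      "embedded_prohorov (X n) Y Z f g < gromov_prohorov (X n) Y + 1 / real (Suc n)"
      by (rule gromov_prohorov_lessE[OF X Y])
    from chi_close[OF X Y this a]
    have "\<bar>chi A (X n) - chi A Y\<bar> \<le>
        k * ((2 * sum a (index_pairs k) + 1) * (gromov_prohorov (X n) Y + 1 / real (Suc n)))"
      unfolding Array .
    then show ?thesis unfolding c_def real_norm_def by (simp only: mult.assoc)
  qed
  have "(\<lambda>n. c * (gromov_prohorov (X n) Y + 1 / real (Suc n))) \<longlonglongrightarrow> c * (0 + 0)"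
    by (intro tendsto_mult tendsto_add tendsto_const lim LIMSEQ_Suc[OF lim_inverse_n'])
  then have "(\<lambda>n. c * (gromov_prohorov (X n) Y + 1 / real (Suc n))) \<longlonglongrightarrow> 0"
    by (simp only: add_0_left mult_zero_right)
  from Lim_null_comparison[OF always_eventually[OF allI[OF bound]] this]
  show ?thesis by (rule LIM_zero_cancel)
qed simp

section \<open>Functionals determined by the sampled distances\<close>

definition bounded_lip :: "'c metric \<Rightarrow> 'i set \<Rightarrow> (('i \<Rightarrow> 'c) \<Rightarrow> real) \<Rightarrow> bool" where
  "bounded_lip Z J F \<longleftrightarrow> (\<exists>L. lip_on Z J L F) \<and> (\<exists>B. \<forall>x \<in> J \<rightarrow> mspace Z. \<bar>F x\<bar> \<le> B)"

lemma bounded_lip_const: "bounded_lip Z J (\<lambda>_. c)"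
  unfolding bounded_lip_def
proof
  show "\<exists>L. lip_on Z J L (\<lambda>_. c)" by (intro exI[of _ 0]) (simp add: lip_on_def)
qed auto

lemma bounded_lip_add:
  assumes "bounded_lip Z J F" "bounded_lip Z J G"
  shows "bounded_lip Z J (\<lambda>x. F x + G x)"
proof -
  obtain L B L' B' where *: "lip_on Z J L F" "lip_on Z J L' G"
    "\<And>x. x \<in> J \<rightarrow> mspace Z \<Longrightarrow> \<bar>F x\<bar> \<le> B" "\<And>x. x \<in> J \<rightarrow> mspace Z \<Longrightarrow> \<bar>G x\<bar> \<le> B'"
    using assms unfolding bounded_lip_def by blast
  have "lip_on Z J (L + L') (\<lambda>x. F x + G x)"
    unfolding lip_on_def
  proof (intro conjI ballI)
    show "0 \<le> L + L'" using * by (simp add: lip_on_def)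
    fix z w assume zw: "z \<in> J \<rightarrow> mspace Z" "w \<in> J \<rightarrow> mspace Z"
    show "\<bar>F z + G z - (F w + G w)\<bar> \<le> (L + L') * (\<Sum>i\<in>J. mdist Z (z i) (w i))"
      using lip_onD[OF *(1) zw] lip_onD[OF *(2) zw] unfolding distrib_right by linarith
  qed
  moreover have "\<bar>F x + G x\<bar> \<le> B + B'" if "x \<in> J \<rightarrow> mspace Z" for x
    using *(3)[OF that] *(4)[OF that] by linarith
  ultimately show ?thesis unfolding bounded_lip_def by blast
qed

lemma bounded_lip_mult:
  assumes "bounded_lip Z J F" "bounded_lip Z J G"
  shows "bounded_lip Z J (\<lambda>x. F x * G x)"
proof -
  obtain L B L' B' where *: "lip_on Z J L F" "lip_on Z J L' G"
    "\<And>x. x \<in> J \<rightarrow> mspace Z \<Longrightarrow> \<bar>F x\<bar> \<le> B" "\<And>x. x \<in> J \<rightarrow> mspace Z \<Longrightarrow> \<bar>G x\<bar> \<le> B'"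
    using assms unfolding bounded_lip_def by blast
  have L: "0 \<le> L" "0 \<le> L'" using * by (auto simp: lip_on_def)
  have "lip_on Z J (L * \<bar>B'\<bar> + \<bar>B\<bar> * L') (\<lambda>x. F x * G x)"
    unfolding lip_on_def
  proof (intro conjI ballI)
    show "0 \<le> L * \<bar>B'\<bar> + \<bar>B\<bar> * L'" using L by simp
    fix z w assume zw: "z \<in> J \<rightarrow> mspace Z" "w \<in> J \<rightarrow> mspace Z"
    let ?S = "\<Sum>i\<in>J. mdist Z (z i) (w i)"
    have S: "0 \<le> ?S" by (intro sum_nonneg) simp
    have "\<bar>F z * G z - F w * G w\<bar> = \<bar>(F z - F w) * G z + F w * (G z - G w)\<bar>"
      by (simp add: algebra_simps)
    also have "\<dots> \<le> \<bar>F z - F w\<bar> * \<bar>G z\<bar> + \<bar>F w\<bar> * \<bar>G z - G w\<bar>"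
      by (metis abs_mult abs_triangle_ineq)
    also have "\<dots> \<le> (L * ?S) * \<bar>B'\<bar> + \<bar>B\<bar> * (L' * ?S)"
      using lip_onD[OF *(1) zw] lip_onD[OF *(2) zw] *(3)[OF zw(2)] *(4)[OF zw(1)] L S
      by (intro add_mono mult_mono) auto
    finally show "\<bar>F z * G z - F w * G w\<bar> \<le> (L * \<bar>B'\<bar> + \<bar>B\<bar> * L') * ?S"
      by (simp add: algebra_simps)
  qed
  moreover have "\<bar>F x * G x\<bar> \<le> \<bar>B\<bar> * \<bar>B'\<bar>" if "x \<in> J \<rightarrow> mspace Z" for x
    using *(3)[OF that] *(4)[OF that] unfolding abs_mult by (intro mult_mono) auto
  ultimately show ?thesis unfolding bounded_lip_def by blast
qed

lemma bounded_lip_subset: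
  assumes "bounded_lip Z J F" "J \<subseteq> J'" "finite J'"
  shows "bounded_lip Z J' F"
proof -
  have "J' \<rightarrow> mspace Z \<subseteq> J \<rightarrow> mspace Z" using assms(2) by auto
  then show ?thesis
    using assms lip_on_subset[OF _ assms(2,3)] unfolding bounded_lip_def by (meson subsetD)
qed

lemma bounded_lip_integrable:
  assumes "mm_space X" "finite J" "bounded_lip (mm_metric X) J F"
  shows "integrable (PiM J (\<lambda>_. mm_measure X)) F"
  using assms lip_on_integrable unfolding bounded_lip_def by metis

lemma bounded_lip_pair_exp:
  assumes "S \<subseteq> J \<times> J" "finite J" "\<And>p. 0 \<le> a p"
  shows "bounded_lip Z J (pair_exp Z S a)"
  unfolding bounded_lip_def
proof
  show "\<exists>L. lip_on Z J L (pair_exp Z S a)" using pair_exp_lip_on[OF assms(1,2)] assms(3) by blast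
  show "\<exists>B. \<forall>x \<in> J \<rightarrow> mspace Z. \<bar>pair_exp Z S a x\<bar> \<le> B"
    using pair_exp_bounds[of S a Z] assms(3) by (intro exI[of _ 1]) simp
qed

lemma bounded_lip_integral_insert:
  assumes "mm_space X" "finite J" "i \<notin> J" "bounded_lip (mm_metric X) (insert i J) F"
  shows "(\<integral>x. F x \<partial>PiM (insert i J) (\<lambda>_. mm_measure X)) =
    (\<integral>x. (\<integral>y. F (x(i := y)) \<partial>mm_measure X) \<partial>PiM J (\<lambda>_. mm_measure X))"
  using assms lip_on_integral_insert unfolding bounded_lip_def by metis

lemma isometric_embedding_ident: "isometric_embedding Z Z (\<lambda>x. x)"
  by (simp add: isometric_embedding_def)

lemma bounded_lip_integral:
  assumes X: "mm_space X" and J: "finite J" "i \<notin> J"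
    and F: "bounded_lip (mm_metric X) (insert i J) F"
  shows "bounded_lip (mm_metric X) J (\<lambda>x. \<integral>y. F (x(i := y)) \<partial>mm_measure X)"
proof -
  interpret prob_space "mm_measure X" by (rule mm_space_prob[OF X])
  let ?Z = "mm_metric X"
  obtain L B where L: "lip_on ?Z (insert i J) L F"
    and B: "\<And>x. x \<in> insert i J \<rightarrow> mspace ?Z \<Longrightarrow> \<bar>F x\<bar> \<le> B"
    using F unfolding bounded_lip_def by blast
  have int: "integrable (mm_measure X) (\<lambda>y. F (x(i := y)))" if "x \<in> J \<rightarrow> mspace ?Z" for x
    using lip_on_slice_integrable[OF X isometric_embedding_ident J L B that] by blast
  have "lip_on ?Z J L (\<lambda>x. \<integral>y. F (x(i := y)) \<partial>mm_measure X)"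
    by (rule lip_on_integral[OF prob_space_axioms _ J L int]) (auto simp: mm_space_space[OF X])
  moreover have "\<bar>\<integral>y. F (x(i := y)) \<partial>mm_measure X\<bar> \<le> B" if x: "x \<in> J \<rightarrow> mspace ?Z" for x
  proof -
    have "\<bar>\<integral>y. F (x(i := y)) \<partial>mm_measure X\<bar> \<le> (\<integral>y. \<bar>F (x(i := y))\<bar> \<partial>mm_measure X)"
      by (rule integral_abs_bound)
    also have "\<dots> \<le> B"
    proof (intro integral_le_const AE_I2)
      fix y assume "y \<in> space (mm_measure X)"
      then show "\<bar>F (x(i := y))\<bar> \<le> B" using x by (intro B) (auto simp: mm_space_space[OF X])
    qed (use int[OF x] in auto)
    finally show ?thesis .
  qed
  ultimately show ?thesis unfolding bounded_lip_def by blast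
qed

lemma pair_exp_restrict: "pair_exp Z S (restrict a S) = pair_exp Z S a"
  by (auto simp: pair_exp_def fun_eq_iff intro!: sum.cong)

lemma index_pairs_Suc: "index_pairs (Suc m) = index_pairs m \<union> {1..m} \<times> {Suc m}"
  by (auto simp: index_pairs_def)

text \<open>The number \<open>K\<close> of points in the net is fixed, while the number \<open>m\<close> of sampled points below
  varies.\<close>

locale chi_convergent =
  fixes X :: "nat \<Rightarrow> 'a mm" and Y :: "'b mm" and K :: nat
  assumes X: "\<And>n. mm_space (X n)" and Y: "mm_space Y"
    and chi_tendsto: "\<And>A. A \<in> arrays \<Longrightarrow> (\<lambda>n. chi A (X n)) \<longlonglongrightarrow> chi A Y"
begin

abbreviation dX :: "nat \<Rightarrow> 'a metric" where "dX n \<equiv> mm_metric (X n)"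
abbreviation dY :: "'b metric" where "dY \<equiv> mm_metric Y"
abbreviation PX :: "nat \<Rightarrow> nat \<Rightarrow> (nat \<Rightarrow> 'a) measure" where
  "PX m n \<equiv> PiM {1..m} (\<lambda>_. mm_measure (X n))"
abbreviation PY :: "nat \<Rightarrow> (nat \<Rightarrow> 'b) measure" where
  "PY m \<equiv> PiM {1..m} (\<lambda>_. mm_measure Y)"

lemma pair_exp_tendsto:
  assumes a: "\<And>p. 0 \<le> a p"
  shows "(\<lambda>n. \<integral>x. pair_exp (dX n) (index_pairs m) a x \<partial>PX m n) \<longlonglongrightarrow>
    (\<integral>y. pair_exp dY (index_pairs m) a y \<partial>PY m)"
proof (cases "2 \<le> m")
  case True
  let ?a = "restrict a (index_pairs m)"
  have "Array m ?a \<in> arrays" using True a by (auto simp: arrays_def)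
  from chi_tendsto[OF this] show ?thesis unfolding chi_eq_pair_exp pair_exp_restrict .
next
  case False
  then have "index_pairs m = {}" by (auto simp: index_pairs_def)
  then show ?thesis
    by (simp add: pair_exp_def prob_space.prob_space[OF prob_space_PiM_mm[OF X]]
        prob_space.prob_space[OF prob_space_PiM_mm[OF Y]])
qed

text \<open>Pairs of functions of the first \<open>K\<close> sampled points, one for the \<open>X\<^sub>n\<close> and one for \<open>Y\<close>, whose
  integrals converge against the integrand of every \<open>\<chi>\<^sub>A\<close> on \<open>m \<ge> K\<close> points. Allowing all \<open>m\<close> leaves
  room for absorbing further sampled points.\<close>

definition test_pair :: "(nat \<Rightarrow> (nat \<Rightarrow> 'a) \<Rightarrow> real) \<Rightarrow> ((nat \<Rightarrow> 'b) \<Rightarrow> real) \<Rightarrow> bool" where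
  "test_pair G H \<longleftrightarrow>
     (\<forall>n. bounded_lip (dX n) {1..K} (G n)) \<and> bounded_lip dY {1..K} H \<and>
     (\<forall>m a. K \<le> m \<and> (\<forall>p. 0 \<le> a p) \<longrightarrow>
       (\<lambda>n. \<integral>x. G n x * pair_exp (dX n) (index_pairs m) a x \<partial>PX m n) \<longlonglongrightarrow>
       (\<integral>y. H y * pair_exp dY (index_pairs m) a y \<partial>PY m))"

text \<open>Multipliers of test pairs are closed under products by definition, so that polynomials
  can be treated without any bookkeeping of the additional sampled points.\<close>

definition multiplier :: "(nat \<Rightarrow> (nat \<Rightarrow> 'a) \<Rightarrow> real) \<Rightarrow> ((nat \<Rightarrow> 'b) \<Rightarrow> real) \<Rightarrow> bool" where
  "multiplier P Q \<longleftrightarrow>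
     (\<forall>G H. test_pair G H \<longrightarrow> test_pair (\<lambda>n x. P n x * G n x) (\<lambda>y. Q y * H y))"

lemma test_pairD:
  assumes "test_pair G H" "K \<le> m" "\<And>p. 0 \<le> a p"
  shows "(\<lambda>n. \<integral>x. G n x * pair_exp (dX n) (index_pairs m) a x \<partial>PX m n) \<longlonglongrightarrow>
    (\<integral>y. H y * pair_exp dY (index_pairs m) a y \<partial>PY m)"
  using assms by (simp add: test_pair_def)

lemma test_pair_one: "test_pair (\<lambda>_ _. 1) (\<lambda>_. 1)"
  unfolding test_pair_def mult_1 using pair_exp_tendsto by (blast intro: bounded_lip_const)

lemma test_pair_integrable:
  assumes "test_pair G H" "K \<le> m" "\<And>p. 0 \<le> a p"
  shows "integrable (PX m n) (\<lambda>x. G n x * pair_exp (dX n) (index_pairs m) a x)"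
    and "integrable (PY m) (\<lambda>y. H y * pair_exp dY (index_pairs m) a y)"
proof -
  have "bounded_lip (dX n) {1..m} (G n)" "bounded_lip dY {1..m} H"
    using assms(1,2) by (auto simp: test_pair_def intro: bounded_lip_subset)
  then show "integrable (PX m n) (\<lambda>x. G n x * pair_exp (dX n) (index_pairs m) a x)"
    "integrable (PY m) (\<lambda>y. H y * pair_exp dY (index_pairs m) a y)"
    using assms(3) index_pairs_subset[of m]
    by (auto intro!: bounded_lip_integrable X Y bounded_lip_mult bounded_lip_pair_exp)
qed

lemma test_pair_add:
  assumes "test_pair G H" "test_pair G' H'"
  shows "test_pair (\<lambda>n x. G n x + G' n x) (\<lambda>y. H y + H' y)"
  using assms test_pair_integrable[OF assms(1)] test_pair_integrable[OF assms(2)]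
  unfolding test_pair_def
  by (auto simp: distrib_right bounded_lip_add intro!: tendsto_add)

lemma test_pair_cmult:
  assumes "test_pair G H"
  shows "test_pair (\<lambda>n x. c * G n x) (\<lambda>y. c * H y)"
  using assms unfolding test_pair_def
  by (auto simp: mult.assoc bounded_lip_mult bounded_lip_const intro!: tendsto_mult_left)

lemma multiplier_test_pair: "multiplier P Q \<Longrightarrow> test_pair P Q"
  using test_pair_one unfolding multiplier_def by fastforce

lemma multiplier_const: "multiplier (\<lambda>_ _. c) (\<lambda>_. c)"
  by (simp add: multiplier_def test_pair_cmult)

lemma multiplier_add:
  "multiplier P Q \<Longrightarrow> multiplier P' Q' \<Longrightarrow> multiplier (\<lambda>n x. P n x + P' n x) (\<lambda>y. Q y + Q' y)"
  by (simp add: multiplier_def distrib_right test_pair_add)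

lemma multiplier_mult:
  "multiplier P Q \<Longrightarrow> multiplier P' Q' \<Longrightarrow> multiplier (\<lambda>n x. P n x * P' n x) (\<lambda>y. Q y * Q' y)"
  by (simp add: multiplier_def mult.assoc)

lemma multiplier_sum:
  assumes "finite D" "\<And>d. d \<in> D \<Longrightarrow> multiplier (P d) (Q d)"
  shows "multiplier (\<lambda>n x. \<Sum>d\<in>D. P d n x) (\<lambda>y. \<Sum>d\<in>D. Q d y)"
  using assms by (induction D rule: finite_induct) (auto intro: multiplier_const multiplier_add)

lemma multiplier_prod:
  assumes "finite D" "\<And>d. d \<in> D \<Longrightarrow> multiplier (P d) (Q d)"
  shows "multiplier (\<lambda>n x. \<Prod>d\<in>D. P d n x) (\<lambda>y. \<Prod>d\<in>D. Q d y)"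
  using assms by (induction D rule: finite_induct) (auto intro: multiplier_const multiplier_mult)

lemma multiplier_power:
  assumes "multiplier P Q"
  shows "multiplier (\<lambda>n x. P n x ^ N) (\<lambda>y. Q y ^ N)"
  using assms by (induction N) (auto intro: multiplier_const multiplier_mult)

text \<open>The factor \<open>exp (- r (x\<^sub>i, x\<^sub>j))\<close> only raises the entry \<open>(i, j)\<close> of the array by \<open>1\<close>.\<close>

lemma multiplier_exp_dist:
  assumes ij: "(i, j) \<in> index_pairs K"
  shows "multiplier (\<lambda>n x. exp (- mdist (dX n) (x i) (x j))) (\<lambda>y. exp (- mdist dY (y i) (y j)))"
proof -
  have shift: "exp (- mdist Z (x i) (x j)) * pair_exp Z (index_pairs m) a x =
      pair_exp Z (index_pairs m) (\<lambda>p. a p + of_bool (p = (i, j))) x" if "K \<le> m"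
    for Z :: "'z metric" and x m a
  proof -
    have mem: "(i, j) \<in> index_pairs m" using ij that by (auto simp: index_pairs_def)
    have "(\<Sum>(k, l)\<in>index_pairs m. (a (k, l) + of_bool ((k, l) = (i, j))) * mdist Z (x k) (x l)) =
        (\<Sum>(k, l)\<in>index_pairs m. a (k, l) * mdist Z (x k) (x l)) +
        (\<Sum>(k, l)\<in>index_pairs m. of_bool ((k, l) = (i, j)) * mdist Z (x k) (x l))"
      by (simp add: distrib_right sum.distrib case_prod_beta)
    also have "(\<Sum>(k, l)\<in>index_pairs m. of_bool ((k, l) = (i, j)) * mdist Z (x k) (x l)) =
        (\<Sum>p\<in>index_pairs m. if p = (i, j) then mdist Z (x i) (x j) else 0)"
      by (intro sum.cong) auto
    also have "\<dots> = mdist Z (x i) (x j)" using mem finite_index_pairs by simp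
    finally show ?thesis by (simp add: pair_exp_def flip: exp_add)
  qed
  have bl: "bounded_lip Z {1..K} (\<lambda>x. exp (- mdist Z (x i) (x j)))" for Z :: "'z metric"
    using bounded_lip_pair_exp[of "{(i, j)}" "{1..K}" "\<lambda>_. 1" Z] ij
    by (auto simp: pair_exp_def[abs_def] index_pairs_def)
  have rearrange: "exp (- mdist Z (x i) (x j)) * g * pair_exp Z (index_pairs m) a x =
      g * pair_exp Z (index_pairs m) (\<lambda>p. a p + of_bool (p = (i, j))) x" if "K \<le> m"
    for Z :: "'z metric" and x m a g
    unfolding shift[OF that, symmetric] by simp
  show ?thesis
    unfolding multiplier_def
  proof (intro allI impI)
    fix G H assume GH: "test_pair G H"
    show "test_pair (\<lambda>n x. exp (- mdist (dX n) (x i) (x j)) * G n x)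
        (\<lambda>y. exp (- mdist dY (y i) (y j)) * H y)"
      unfolding test_pair_def
    proof (intro conjI allI impI)
      fix m and a :: "nat \<times> nat \<Rightarrow> real" assume ma: "K \<le> m \<and> (\<forall>p. 0 \<le> a p)"
      then have m: "K \<le> m" by simp
      show "(\<lambda>n. \<integral>x. exp (- mdist (dX n) (x i) (x j)) * G n x *
              pair_exp (dX n) (index_pairs m) a x \<partial>PX m n) \<longlonglongrightarrow>
          (\<integral>y. exp (- mdist dY (y i) (y j)) * H y * pair_exp dY (index_pairs m) a y \<partial>PY m)"
        unfolding rearrange[OF m] using GH ma by (auto simp: test_pair_def)
    qed (use GH in \<open>auto simp: test_pair_def simp del: One_nat_def intro!: bounded_lip_mult bl\<close>)
  qed
qed

definition monomial_mean :: "'c mm \<Rightarrow> (nat \<Rightarrow> real) \<Rightarrow> (nat \<Rightarrow> 'c) \<Rightarrow> real" where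
  "monomial_mean W \<alpha> x =
     (\<integral>y. exp (- (\<Sum>i\<in>{1..K}. \<alpha> i * mdist (mm_metric W) (x i) y)) \<partial>mm_measure W)"

text \<open>The index \<open>0\<close>, which is not in \<open>{1..K}\<close>, serves for the point that is integrated out.\<close>

lemma bounded_lip_monomial_mean:
  assumes W: "mm_space W" and \<alpha>: "\<And>i. 0 \<le> \<alpha> i"
  shows "bounded_lip (mm_metric W) {1..K} (monomial_mean W \<alpha>)"
proof -
  let ?F = "pair_exp (mm_metric W) ({1..K} \<times> {0}) (\<lambda>(i, _). \<alpha> i)"
  have "bounded_lip (mm_metric W) {1..K} (\<lambda>x. \<integral>y. ?F (x(0 := y)) \<partial>mm_measure W)"
    using \<alpha> by (intro bounded_lip_integral W bounded_lip_pair_exp) auto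
  moreover have "?F (x(0 := y)) = exp (- (\<Sum>i\<in>{1..K}. \<alpha> i * mdist (mm_metric W) (x i) y))" for x y
    unfolding pair_exp_def by (subst sum.cartesian_product[symmetric]) (auto intro!: sum.cong)
  ultimately show ?thesis by (simp add: monomial_mean_def[abs_def])
qed

text \<open>The point over which the mean is taken becomes the sampled point number \<open>m + 1\<close>; the
  array gets a new column with entries \<open>\<alpha>\<^sub>i\<close> for the points of the net and \<open>0\<close> for the other
  points.\<close>

lemma integral_monomial_mean:
  assumes W: "mm_space W" and g: "bounded_lip (mm_metric W) {1..K} g" and m: "K \<le> m"
    and a: "\<And>p. 0 \<le> a p" and \<alpha>: "\<And>i. 0 \<le> \<alpha> i"
  shows "(\<integral>x. monomial_mean W \<alpha> x * g x * pair_exp (mm_metric W) (index_pairs m) a x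
        \<partial>PiM {1..m} (\<lambda>_. mm_measure W)) =
    (\<integral>x. g x * pair_exp (mm_metric W) (index_pairs (Suc m))
          (\<lambda>(i, j). if j = Suc m then (if i \<le> K then \<alpha> i else 0) else a (i, j)) x
        \<partial>PiM {1..Suc m} (\<lambda>_. mm_measure W))"
    (is "?L = (\<integral>x. g x * pair_exp ?d _ ?b x \<partial>_)")
proof -
  have b: "0 \<le> ?b p" for p using a \<alpha> by (auto split: prod.split)
  have ins: "{1..Suc m} = insert (Suc m) {1..m}" by auto
  have "bounded_lip ?d {1..Suc m} g" using g m by (auto intro: bounded_lip_subset)
  then have bl: "bounded_lip ?d (insert (Suc m) {1..m}) (\<lambda>x. g x * pair_exp ?d (index_pairs (Suc m)) ?b x)"
    unfolding ins[symmetric] using b index_pairs_subset[of "Suc m"]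
    by (intro bounded_lip_mult bounded_lip_pair_exp) auto
  have eq: "g (x(Suc m := y)) * pair_exp ?d (index_pairs (Suc m)) ?b (x(Suc m := y)) =
      exp (- (\<Sum>i\<in>{1..K}. \<alpha> i * mdist ?d (x i) y)) * (g x * pair_exp ?d (index_pairs m) a x)"
    if x: "x \<in> {1..m} \<rightarrow> mspace ?d" for x y
  proof -
    obtain L where L: "lip_on ?d {1..K} L g" using g by (auto simp: bounded_lip_def)
    have "g (x(Suc m := y)) = g x" by (rule lip_on_cong[OF L]) (use x m in auto)
    moreover have "(\<Sum>(i, j)\<in>index_pairs (Suc m). ?b (i, j) *
          mdist ?d ((x(Suc m := y)) i) ((x(Suc m := y)) j)) =
        (\<Sum>(i, j)\<in>index_pairs m. a (i, j) * mdist ?d (x i) (x j)) +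
        (\<Sum>i\<in>{1..K}. \<alpha> i * mdist ?d (x i) y)"
    proof -
      have "index_pairs m \<inter> {1..m} \<times> {Suc m} = {}" by (auto simp: index_pairs_def)
      then have "(\<Sum>(i, j)\<in>index_pairs (Suc m). ?b (i, j) *
          mdist ?d ((x(Suc m := y)) i) ((x(Suc m := y)) j)) =
        (\<Sum>(i, j)\<in>index_pairs m. ?b (i, j) * mdist ?d ((x(Suc m := y)) i) ((x(Suc m := y)) j)) +
        (\<Sum>(i, j)\<in>{1..m} \<times> {Suc m}. ?b (i, j) * mdist ?d ((x(Suc m := y)) i) ((x(Suc m := y)) j))"
        unfolding index_pairs_Suc using finite_index_pairs by (intro sum.union_disjoint) auto
      also have "(\<Sum>(i, j)\<in>index_pairs m. ?b (i, j) * mdist ?d ((x(Suc m := y)) i) ((x(Suc m := y)) j)) =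
          (\<Sum>(i, j)\<in>index_pairs m. a (i, j) * mdist ?d (x i) (x j))"
        by (intro sum.cong) (auto simp: index_pairs_def)
      also have "(\<Sum>(i, j)\<in>{1..m} \<times> {Suc m}. ?b (i, j) *
          mdist ?d ((x(Suc m := y)) i) ((x(Suc m := y)) j)) =
          (\<Sum>i\<in>{1..m}. (if i \<le> K then \<alpha> i else 0) * mdist ?d (x i) y)"
        by (subst sum.cartesian_product[symmetric]) (auto intro!: sum.cong)
      also have "\<dots> = (\<Sum>i\<in>{1..K}. \<alpha> i * mdist ?d (x i) y)"
        using m by (intro sum.mono_neutral_cong_right) auto
      finally show ?thesis .
    qed
    ultimately show ?thesis
      by (simp only: pair_exp_def minus_add_distrib exp_add mult_ac)
  qed
  have "(\<integral>x. g x * pair_exp ?d (index_pairs (Suc m)) ?b x \<partial>PiM {1..Suc m} (\<lambda>_. mm_measure W)) =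
      (\<integral>x. (\<integral>y. g (x(Suc m := y)) * pair_exp ?d (index_pairs (Suc m)) ?b (x(Suc m := y))
        \<partial>mm_measure W) \<partial>PiM {1..m} (\<lambda>_. mm_measure W))"
    unfolding ins by (intro bounded_lip_integral_insert[OF W _ _ bl]) auto
  also have "\<dots> = ?L"
  proof (intro Bochner_Integration.integral_cong refl)
    fix x assume "x \<in> space (PiM {1..m} (\<lambda>_. mm_measure W))"
    then have x: "x \<in> {1..m} \<rightarrow> mspace ?d" by (auto simp: space_PiM_mm[OF W])
    show "(\<integral>y. g (x(Suc m := y)) * pair_exp ?d (index_pairs (Suc m)) ?b (x(Suc m := y))
        \<partial>mm_measure W) = monomial_mean W \<alpha> x * g x * pair_exp ?d (index_pairs m) a x"
      unfolding eq[OF x] by (simp add: monomial_mean_def mult.assoc)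
  qed
  finally show ?thesis by simp
qed

lemma multiplier_monomial_mean:
  assumes \<alpha>: "\<And>i. 0 \<le> \<alpha> i"
  shows "multiplier (\<lambda>n. monomial_mean (X n) \<alpha>) (monomial_mean Y \<alpha>)"
  unfolding multiplier_def
proof (intro allI impI)
  fix G H assume GH: "test_pair G H"
  then have bl: "\<And>n. bounded_lip (dX n) {1..K} (G n)" "bounded_lip dY {1..K} H"
    by (auto simp: test_pair_def)
  show "test_pair (\<lambda>n x. monomial_mean (X n) \<alpha> x * G n x) (\<lambda>y. monomial_mean Y \<alpha> y * H y)"
    unfolding test_pair_def
  proof (intro conjI allI impI)
    fix m and a :: "nat \<times> nat \<Rightarrow> real" assume ma: "K \<le> m \<and> (\<forall>p. 0 \<le> a p)"
    let ?b = "\<lambda>(i, j). if j = Suc m then (if i \<le> K then \<alpha> i else 0) else a (i, j)"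
    have "0 \<le> ?b p" for p using ma \<alpha> by (auto split: prod.split)
    then have "(\<lambda>n. \<integral>x. G n x * pair_exp (dX n) (index_pairs (Suc m)) ?b x \<partial>PX (Suc m) n)
        \<longlonglongrightarrow> (\<integral>y. H y * pair_exp dY (index_pairs (Suc m)) ?b y \<partial>PY (Suc m))"
      using ma by (intro test_pairD[OF GH]) auto
    moreover have "(\<integral>x. monomial_mean (X n) \<alpha> x * G n x * pair_exp (dX n) (index_pairs m) a x \<partial>PX m n) =
        (\<integral>x. G n x * pair_exp (dX n) (index_pairs (Suc m)) ?b x \<partial>PX (Suc m) n)" for n
      using ma by (intro integral_monomial_mean X bl \<alpha>) auto
    moreover have "(\<integral>y. monomial_mean Y \<alpha> y * H y * pair_exp dY (index_pairs m) a y \<partial>PY m) =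
        (\<integral>y. H y * pair_exp dY (index_pairs (Suc m)) ?b y \<partial>PY (Suc m))"
      using ma by (intro integral_monomial_mean Y bl \<alpha>) auto
    ultimately show "(\<lambda>n. \<integral>x. monomial_mean (X n) \<alpha> x * G n x *
            pair_exp (dX n) (index_pairs m) a x \<partial>PX m n) \<longlonglongrightarrow>
        (\<integral>y. monomial_mean Y \<alpha> y * H y * pair_exp dY (index_pairs m) a y \<partial>PY m)"
      by (simp only:)
  qed (intro bounded_lip_mult bounded_lip_monomial_mean X Y bl \<alpha>)+
qed

end

section \<open>Realising a configuration of the limit space\<close>

context chi_convergent
begin

lemma ball_measure_pos:
  assumes "y \<in> mspace dY" "0 < r"
  shows "0 < measure (mm_measure Y) {v \<in> mspace dY. mdist dY y v < r}"
proof -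
  interpret prob_space "mm_measure Y" by (rule mm_space_prob[OF Y])
  have "mdist dY y y = 0" using assms by simp
  then have "y \<in> {v \<in> mspace dY. mdist dY y v < r}" using assms by (simp del: mdist_zero)
  then have "0 < emeasure (mm_measure Y) {v \<in> mspace dY. mdist dY y v < r}"
    using Y openin_open_ball[OF assms(1), of r] unfolding mm_space_def full_support_def by blast
  then show ?thesis by (simp add: emeasure_eq_measure)
qed

text \<open>The polynomial \<open>p = \<Prod>\<^sub>d (1 - (P\<^sub>d - Q\<^sub>d y)\<^sup>2)\<close> is at most \<open>1 - e\<^sup>2\<close> at every point
  where some \<open>P\<^sub>d\<close> is off by \<open>e\<close> or more. If \<open>X\<^sub>n\<close> had only such points, then the integral of
  \<open>p\<^sup>N\<close> over \<open>X\<^sub>n\<close> would be at most \<open>(1 - e\<^sup>2)\<^sup>N\<close>. The corresponding polynomial on \<open>Y\<close> is \<open>1\<close> at \<open>y\<close>, hence at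
  least \<open>1 - e\<^sup>2/2\<close> on a neighbourhood of \<open>y\<close>, which has positive mass since the measure has full
  support; so for suitable \<open>N\<close> its \<open>N\<close>-th power has a larger integral, and these integrals
  converge.\<close>

lemma eventually_realised:
  fixes P :: "'d \<Rightarrow> nat \<Rightarrow> (nat \<Rightarrow> 'a) \<Rightarrow> real" and Q :: "'d \<Rightarrow> (nat \<Rightarrow> 'b) \<Rightarrow> real"
  assumes D: "finite D" and mult: "\<And>d. d \<in> D \<Longrightarrow> multiplier (P d) (Q d)"
    and P: "\<And>d n x. d \<in> D \<Longrightarrow> x \<in> {1..K} \<rightarrow> mspace (dX n) \<Longrightarrow> 0 \<le> P d n x \<and> P d n x \<le> 1"
    and Q: "\<And>d y. d \<in> D \<Longrightarrow> y \<in> {1..K} \<rightarrow> mspace dY \<Longrightarrow> 0 \<le> Q d y \<and> Q d y \<le> 1"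
    and y: "y \<in> {1..K} \<rightarrow> mspace dY" and e: "0 < e" "e < 1"
  shows "\<forall>\<^sub>F n in sequentially. \<exists>x \<in> {1..K} \<rightarrow> mspace (dX n). \<forall>d\<in>D. \<bar>P d n x - Q d y\<bar> < e"
proof -
  (* written with sums and products only, the operations under which multipliers are closed *)
  define p where "p = (\<lambda>n x. \<Prod>d\<in>D. 1 + (- 1) * ((P d n x + - Q d y) ^ 2))"
  define q where "q = (\<lambda>z. \<Prod>d\<in>D. 1 + (- 1) * ((Q d z + - Q d y) ^ 2))"
  have pq: "multiplier p q"
    unfolding p_def q_def using D mult
    by (intro multiplier_prod multiplier_add multiplier_mult multiplier_power multiplier_const) auto
  have sq: "(s + - t)\<^sup>2 \<le> 1" if "0 \<le> s" "s \<le> 1" "0 \<le> t" "t \<le> 1" for s t :: real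
    using that abs_square_le_1[of "s + - t"] by auto
  have p01: "0 \<le> p n x" "p n x \<le> 1" if "x \<in> {1..K} \<rightarrow> mspace (dX n)" for n x
    unfolding p_def using P Q that y sq by (auto intro!: prod_nonneg prod_le_1)
  have q01: "0 \<le> q z" "q z \<le> 1" if "z \<in> {1..K} \<rightarrow> mspace dY" for z
    unfolding q_def using Q that y sq by (auto intro!: prod_nonneg prod_le_1)
  have qy: "q y = 1" by (simp add: q_def)
  have far: "p n x \<le> 1 - e\<^sup>2"
    if x: "x \<in> {1..K} \<rightarrow> mspace (dX n)" and d: "d \<in> D" "e \<le> \<bar>P d n x - Q d y\<bar>" for n x d
  proof -
    have "p n x = (1 + (- 1) * ((P d n x + - Q d y) ^ 2)) *
        (\<Prod>d\<in>D - {d}. 1 + (- 1) * ((P d n x + - Q d y) ^ 2))"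
      unfolding p_def using D d by (intro prod.remove) auto
    also have "\<dots> \<le> (1 + (- 1) * ((P d n x + - Q d y) ^ 2)) * 1"
    proof (rule mult_left_mono)
      show "(\<Prod>d\<in>D - {d}. 1 + (- 1) * ((P d n x + - Q d y) ^ 2)) \<le> 1"
        using P Q x y sq by (intro prod_le_1) auto
      show "0 \<le> 1 + - 1 * (P d n x + - Q d y)\<^sup>2" using P Q x y sq d by simp
    qed
    also have "\<dots> \<le> 1 - e\<^sup>2" using power_mono[OF d(2), of 2] e by simp
    finally show ?thesis .
  qed
  have "bounded_lip dY {1..K} q" using multiplier_test_pair[OF pq] by (simp add: test_pair_def)
  then obtain L where L: "lip_on dY {1..K} L q" by (auto simp: bounded_lip_def)
  have L0: "0 \<le> L" using L by (simp add: lip_on_def)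
  (* on the box of radius r around y the function q varies by at most e^2 / 2 *)
  define r where "r = e\<^sup>2 / (2 * (L * K + 1))"
  have den: "0 < L * K + 1" using L0 by (simp add: add_nonneg_pos)
  have r: "0 < r" unfolding r_def using e den by simp
  define U where "U = (\<Pi>\<^sub>E i\<in>{1..K}. {v \<in> mspace dY. mdist dY (y i) v < r})"
  have U: "U \<subseteq> {1..K} \<rightarrow>\<^sub>E mspace dY" by (auto simp: U_def PiE_def Pi_iff)
  have Us: "U \<in> sets (PY K)"
    unfolding U_def using y by (intro sets_PiM_I_finite mm_space_ball_sets[OF Y]) auto
  interpret PY: prob_space "PY K" by (rule prob_space_PiM_mm[OF Y])
  interpret \<nu>: prob_space "mm_measure Y" by (rule mm_space_prob[OF Y])
  interpret fp: finite_product_prob_space "\<lambda>_. mm_measure Y" "{1..K}"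
    by unfold_locales auto
  have Upos: "0 < measure (PY K) U"
  proof -
    have "measure (PY K) U = (\<Prod>i\<in>{1..K}. measure (mm_measure Y) {v \<in> mspace dY. mdist dY (y i) v < r})"
      unfolding U_def using y by (intro fp.finite_measure_PiM_emb mm_space_ball_sets[OF Y]) auto
    also have "\<dots> > 0" using y r by (intro prod_pos ball_measure_pos) auto
    finally show ?thesis .
  qed
  have qU: "1 - e\<^sup>2 / 2 \<le> q z" if z: "z \<in> U" for z
  proof -
    have z': "z \<in> {1..K} \<rightarrow> mspace dY" using z U by auto
    have "\<bar>q y - q z\<bar> \<le> L * (\<Sum>i\<in>{1..K}. mdist dY (y i) (z i))" by (rule lip_onD[OF L y z'])
    also have "\<dots> \<le> L * (card {1..K} * r)"
      using L0 z by (intro mult_left_mono sum_bounded_above) (auto simp: U_def PiE_def Pi_iff less_imp_le)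
    also have "\<dots> \<le> (L * K + 1) * r" using r by (simp add: algebra_simps)
    also have "\<dots> = e\<^sup>2 / 2"
    proof -
      have "a * (b / (2 * a)) = b / 2" if "0 < a" for a b :: real using that by simp
      from this[OF den] show ?thesis by (simp only: r_def)
    qed
    finally show ?thesis using qy by linarith
  qed
  define \<rho> where "\<rho> = (1 - e\<^sup>2) / (1 - e\<^sup>2 / 2)"
  have e2: "0 < e\<^sup>2" "e\<^sup>2 < 1" using e by (auto simp: power_less_one_iff)
  have \<rho>: "0 \<le> \<rho>" "\<rho> < 1" using e2 by (auto simp: \<rho>_def)
  obtain N where N: "\<rho> ^ N < measure (PY K) U"
    using real_arch_pow_inv[OF Upos \<rho>(2)] by blast
  have Nlt: "(1 - e\<^sup>2) ^ N < (1 - e\<^sup>2 / 2) ^ N * measure (PY K) U"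
  proof -
    have "0 < (1 - e\<^sup>2 / 2) ^ N" using e2 by simp
    from N show ?thesis
      unfolding \<rho>_def power_divide pos_divide_less_eq[OF \<open>0 < (1 - e\<^sup>2 / 2) ^ N\<close>]
      by (simp only: mult.commute)
  qed
  have tp: "test_pair (\<lambda>n x. p n x ^ N) (\<lambda>z. q z ^ N)"
    by (intro multiplier_test_pair multiplier_power pq)
  have "pair_exp Z S (\<lambda>_. 0) = (\<lambda>_. 1)" for Z :: "'z metric" and S :: "(nat \<times> nat) set"
    by (simp add: pair_exp_def[abs_def])
  note pair_exp_zero = this
  have lim: "(\<lambda>n. \<integral>x. p n x ^ N \<partial>PX K n) \<longlonglongrightarrow> (\<integral>z. q z ^ N \<partial>PY K)"
    using test_pairD[OF tp order_refl, of "\<lambda>_. 0"] by (simp add: pair_exp_zero)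
  have intp: "integrable (PX K n) (\<lambda>x. p n x ^ N)" for n
    using test_pair_integrable(1)[OF tp order_refl, of "\<lambda>_. 0"] by (simp add: pair_exp_zero)
  have intq: "integrable (PY K) (\<lambda>z. q z ^ N)"
    using test_pair_integrable(2)[OF tp order_refl, of "\<lambda>_. 0"] by (simp add: pair_exp_zero)
  have "(1 - e\<^sup>2 / 2) ^ N * measure (PY K) U = (\<integral>z. (1 - e\<^sup>2 / 2) ^ N * indicator U z \<partial>PY K)"
    using Us by simp
  also have "\<dots> \<le> (\<integral>z. q z ^ N \<partial>PY K)"
  proof (rule integral_mono)
    have "emeasure (PY K) U < \<infinity>"
      using PY.emeasure_finite[of U] by (metis less_top infinity_ennreal_def)
    then show "integrable (PY K) (\<lambda>z. (1 - e\<^sup>2 / 2) ^ N * indicator U z)"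
      by (intro integrable_mult_right integrable_real_indicator Us)
    fix z assume "z \<in> space (PY K)"
    then have "z \<in> {1..K} \<rightarrow> mspace dY" by (auto simp: space_PiM_mm[OF Y])
    then have "0 \<le> q z" by (rule q01)
    then show "(1 - e\<^sup>2 / 2) ^ N * indicator U z \<le> q z ^ N"
      using qU e2 by (auto simp: indicator_def intro!: power_mono)
  qed (rule intq)
  finally have "(1 - e\<^sup>2) ^ N < (\<integral>z. q z ^ N \<partial>PY K)" using Nlt by linarith
  then have "\<forall>\<^sub>F n in sequentially. (1 - e\<^sup>2) ^ N < (\<integral>x. p n x ^ N \<partial>PX K n)"
    using order_tendstoD(1)[OF lim] by blast
  then show ?thesis
  proof (rule eventually_mono)
    fix n assume gt: "(1 - e\<^sup>2) ^ N < (\<integral>x. p n x ^ N \<partial>PX K n)"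
    show "\<exists>x \<in> {1..K} \<rightarrow> mspace (dX n). \<forall>d\<in>D. \<bar>P d n x - Q d y\<bar> < e"
    proof (rule ccontr)
      assume none: "\<not> (\<exists>x \<in> {1..K} \<rightarrow> mspace (dX n). \<forall>d\<in>D. \<bar>P d n x - Q d y\<bar> < e)"
      interpret PX: prob_space "PX K n" by (rule prob_space_PiM_mm[OF X])
      have "(\<integral>x. p n x ^ N \<partial>PX K n) \<le> (1 - e\<^sup>2) ^ N"
      proof (intro PX.integral_le_const intp AE_I2)
        fix x assume "x \<in> space (PX K n)"
        then have x: "x \<in> {1..K} \<rightarrow> mspace (dX n)" by (auto simp: space_PiM_mm[OF X])
        then obtain d where "d \<in> D" "e \<le> \<bar>P d n x - Q d y\<bar>" using none by (auto simp: not_less)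
        then show "p n x ^ N \<le> (1 - e\<^sup>2) ^ N" using far[OF x] p01(1)[OF x] by (intro power_mono) auto
      qed
      then show False using gt by linarith
    qed
  qed
qed

end

section \<open>Polynomial cutoff functions and masses of unions of balls\<close>

text \<open>A Weierstrass approximation of a piecewise linear cutoff. The latter is kept between \<open>\<eta>/2\<close> and
  \<open>1 - \<eta>/2\<close>, so that an approximation up to \<open>\<eta>/2\<close> stays in \<open>[0,1]\<close>.\<close>

lemma polynomial_cutoff:
  assumes st: "0 < s" "s < t" "t < (1::real)" and \<eta>: "0 < \<eta>" "\<eta> < 1 / 2"
  obtains d :: nat and c :: "nat \<Rightarrow> real"
  where "\<And>u. 0 \<le> u \<Longrightarrow> u \<le> 1 \<Longrightarrow> 0 \<le> (\<Sum>k\<le>d. c k * u ^ k) \<and> (\<Sum>k\<le>d. c k * u ^ k) \<le> 1"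
    "\<And>u. 0 \<le> u \<Longrightarrow> u \<le> s \<Longrightarrow> 1 - \<eta> \<le> (\<Sum>k\<le>d. c k * u ^ k)"
    "\<And>u. t \<le> u \<Longrightarrow> u \<le> 1 \<Longrightarrow> (\<Sum>k\<le>d. c k * u ^ k) \<le> \<eta>"
proof -
  define f where "f = (\<lambda>u. max (\<eta> / 2) (min (1 - \<eta> / 2) ((t - u) / (t - s))))"
  have "continuous_on {0..1} f"
    unfolding f_def using st by (intro continuous_intros) auto
  then obtain g where g: "real_polynomial_function g"
    "\<And>u. u \<in> {0..1} \<Longrightarrow> \<bar>f u - g u\<bar> < \<eta> / 2"
    using Stone_Weierstrass_real_polynomial_function[of "{0..1}" f "\<eta> / 2"] \<eta> by auto
  obtain c d where gc: "g = (\<lambda>u. \<Sum>k\<le>d. c k * u ^ k)"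
    using g(1) unfolding real_polynomial_function_iff_sum by blast
  have gf: "f u - \<eta> / 2 \<le> g u \<and> g u \<le> f u + \<eta> / 2" if "0 \<le> u" "u \<le> 1" for u
  proof -
    have "\<bar>f u - g u\<bar> < \<eta> / 2" using g(2) that by simp
    then show ?thesis by linarith
  qed
  show thesis
  proof (rule that[of c d]; fold fun_cong[OF gc])
    show "0 \<le> g u \<and> g u \<le> 1" if "0 \<le> u" "u \<le> 1" for u
    proof -
      have "\<eta> / 2 \<le> f u" "f u \<le> 1 - \<eta> / 2" using \<eta> by (auto simp: f_def)
      then show ?thesis using gf[OF that] by linarith
    qed
    show "1 - \<eta> \<le> g u" if "0 \<le> u" "u \<le> s" for u
    proof -
      have "1 \<le> (t - u) / (t - s)" using that st by simp
      then have "1 - \<eta> / 2 \<le> f u" using \<eta> by (auto simp: f_def)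
      then show ?thesis using gf[of u] that st by linarith
    qed
    show "g u \<le> \<eta>" if "t \<le> u" "u \<le> 1" for u
    proof -
      have "(t - u) / (t - s) \<le> 0" using that st by (simp add: divide_nonpos_pos)
      then have "f u \<le> \<eta> / 2" using \<eta> by (auto simp: f_def)
      then show ?thesis using gf[of u] that st by linarith
    qed
  qed
qed

text \<open>If \<open>r\<close> differs from \<open>r' \<le> R\<close> by more than \<open>\<delta>\<close>, then the exponentials differ by at least
  \<open>exp (- r') (1 - exp (- \<delta>))\<close>.\<close>

lemma exp_close_imp_close:
  fixes r r' R \<delta> :: real
  assumes "r' \<le> R" "0 < \<delta>" and close: "\<bar>exp (- r) - exp (- r')\<bar> < exp (- R) * (1 - exp (- \<delta>))"
  shows "\<bar>r - r'\<bar> \<le> \<delta>"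
proof (rule ccontr)
  assume "\<not> \<bar>r - r'\<bar> \<le> \<delta>"
  then consider "r' + \<delta> < r" | "r < r' - \<delta>" by linarith
  then have "exp (- r') * (1 - exp (- \<delta>)) \<le> \<bar>exp (- r) - exp (- r')\<bar>"
  proof cases
    case 1
    then have "exp (- r) \<le> exp (- r') * exp (- \<delta>)" by (simp flip: exp_add)
    then show ?thesis by (simp add: algebra_simps)
  next
    case 2
    then have "exp (- r') \<le> exp (- r) * exp (- \<delta>)" by (simp flip: exp_add)
    moreover have "exp (- r') \<le> exp (- r)" using 2 assms by simp
    ultimately have "exp (- r') * (1 - exp (- \<delta>)) \<le> exp (- r) * (1 - exp (- \<delta>))"
      "exp (- r) * (1 - exp (- \<delta>)) \<le> exp (- r) - exp (- r')"
      using assms by (intro mult_right_mono, simp_all add: right_diff_distrib)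
    then show ?thesis by linarith
  qed
  moreover have "exp (- R) * (1 - exp (- \<delta>)) \<le> exp (- r') * (1 - exp (- \<delta>))"
    using assms by (intro mult_right_mono) auto
  ultimately show False using close by linarith
qed

text \<open>The balls around the points of a dense sequence cover the space, so by continuity from below
  finitely many of them carry almost all of the mass.\<close>

lemma mm_space_finite_net:
  assumes W: "mm_space W" and \<delta>: "0 < \<delta>"
  obtains k :: nat and w where "1 \<le> k" "w \<in> {1..k} \<rightarrow> mspace (mm_metric W)"
    "1 - \<delta> < measure (mm_measure W) (ball_union W {1..k} w \<delta>)"
proof -
  interpret prob_space "mm_measure W" by (rule mm_space_prob[OF W])
  obtain C where C: "countable C" "C \<subseteq> mspace (mm_metric W)"
    "\<And>x e. x \<in> mspace (mm_metric W) \<Longrightarrow> 0 < e \<Longrightarrow> \<exists>c\<in>C. mdist (mm_metric W) c x < e"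
    using mm_space_dense_subset[OF W] by metis
  obtain x0 where "x0 \<in> mspace (mm_metric W)" using not_empty by (auto simp: mm_space_space[OF W])
  then have "C \<noteq> {}" using C(3)[of x0 1] by auto
  define w where "w = from_nat_into C"
  have w: "w i \<in> mspace (mm_metric W)" for i
    using from_nat_into[OF \<open>C \<noteq> {}\<close>] C(2) by (auto simp: w_def)
  define A where "A = (\<lambda>k. ball_union W {0..k} w \<delta>)"
  have As: "range A \<subseteq> sets (mm_measure W)"
    using w by (auto simp: A_def intro!: ball_union_sets[OF W])
  have "incseq A" unfolding A_def ball_union_def by (intro monoI UN_mono) auto
  with As have "(\<lambda>k. measure (mm_measure W) (A k)) \<longlonglongrightarrow> measure (mm_measure W) (\<Union>k. A k)"
    by (rule finite_Lim_measure_incseq)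
  also have "(\<Union>k. A k) = space (mm_measure W)"
  proof (intro equalityI subsetI)
    fix u assume "u \<in> space (mm_measure W)"
    then have u: "u \<in> mspace (mm_metric W)" by (simp add: mm_space_space[OF W])
    then obtain c where "c \<in> C" "mdist (mm_metric W) c u < \<delta>" using C(3) \<delta> by blast
    moreover then obtain i where "w i = c" using from_nat_into_surj[OF C(1)] by (auto simp: w_def)
    ultimately have "u \<in> A i" using u by (auto simp: A_def ball_union_def)
    then show "u \<in> (\<Union>k. A k)" by blast
  qed (auto simp: A_def ball_union_def mm_space_space[OF W])
  finally have "\<forall>\<^sub>F k in sequentially. 1 - \<delta> < measure (mm_measure W) (A k)"
    using \<delta> by (intro order_tendstoD) (auto simp: prob_space)
  then obtain k where k: "1 - \<delta> < measure (mm_measure W) (A k)"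
    by (auto simp: eventually_sequentially)
  have "A k = ball_union W {1..Suc k} (\<lambda>i. w (i - 1)) \<delta>"
  proof -
    have "{0..k} = (\<lambda>i. i - 1) ` {1..Suc k}" by (auto simp: image_iff intro!: bexI[of _ "Suc _"])
    then show ?thesis by (simp add: A_def ball_union_def)
  qed
  with k w show thesis by (intro that[of "Suc k" "\<lambda>i. w (i - 1)"]) auto
qed

lemma mdist_measurable:
  assumes W: "mm_space W" and w: "w \<in> mspace (mm_metric W)"
  shows "mdist (mm_metric W) w \<in> borel_measurable (mm_measure W)"
proof -
  have "mdist (mm_metric W) w \<in> borel_measurable (borel_of (mtopology_of (mm_metric W)))"
  proof (rule lipschitz_measurable_borel_of)
    fix u v assume uv: "u \<in> mspace (mm_metric W)" "v \<in> mspace (mm_metric W)"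
    have "mdist (mm_metric W) w w = 0" using w by simp
    then show "\<bar>mdist (mm_metric W) w u - mdist (mm_metric W) w v\<bar> \<le> 1 * mdist (mm_metric W) u v"
      using mdist_diff_le[OF w uv(1) w uv(2)] by linarith
  qed
  moreover have sets: "sets (mm_measure W) = sets (borel_of (mtopology_of (mm_metric W)))"
    using W by (simp add: mm_space_def)
  ultimately show ?thesis using measurable_cong_sets[OF sets refl] by blast
qed

text \<open>With \<open>p\<close> close to \<open>0\<close> near \<open>1\<close> (small distances) and close to \<open>1\<close> near \<open>0\<close> (large distances), this
  is a smoothed version of the mass outside the balls around the \<open>w\<^sub>i\<close>.\<close>

definition cutoff_mean :: "'c mm \<Rightarrow> (real \<Rightarrow> real) \<Rightarrow> 'i set \<Rightarrow> ('i \<Rightarrow> 'c) \<Rightarrow> real" where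
  "cutoff_mean W p I w = (\<integral>y. (\<Prod>i\<in>I. p (exp (- mdist (mm_metric W) (w i) y))) \<partial>mm_measure W)"

text \<open>Inside a \<open>\<delta>\<close>-ball one factor, and with it the whole product, is at most \<open>\<eta>\<close>. Outside all \<open>2 \<delta>\<close>-balls
  every factor is at least \<open>1 - \<eta>\<close>, and Bernoulli's inequality bounds their product from below.\<close>

lemma cutoff_mean_bounds:
  fixes \<delta> \<eta> :: real
  assumes W: "mm_space W" and I: "finite I" and w: "\<And>i. i \<in> I \<Longrightarrow> w i \<in> mspace (mm_metric W)"
    and p[measurable]: "p \<in> borel_measurable borel"
    and p01: "\<And>u. 0 \<le> u \<Longrightarrow> u \<le> 1 \<Longrightarrow> 0 \<le> p u \<and> p u \<le> 1"
    and p1: "\<And>u. 0 \<le> u \<Longrightarrow> u \<le> exp (- (2 * \<delta>)) \<Longrightarrow> 1 - \<eta> \<le> p u"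
    and p0: "\<And>u. exp (- \<delta>) \<le> u \<Longrightarrow> u \<le> 1 \<Longrightarrow> p u \<le> \<eta>"
    and \<eta>: "0 \<le> \<eta>" "\<eta> \<le> 1"
  shows "0 \<le> cutoff_mean W p I w" "cutoff_mean W p I w \<le> 1"
    and "measure (mm_measure W) (ball_union W I w \<delta>) \<le> 1 + \<eta> - cutoff_mean W p I w"
    and "1 - card I * \<eta> - cutoff_mean W p I w \<le> measure (mm_measure W) (ball_union W I w (2 * \<delta>))"
proof -
  interpret prob_space "mm_measure W" by (rule mm_space_prob[OF W])
  let ?d = "mdist (mm_metric W)"
  let ?f = "\<lambda>y. \<Prod>i\<in>I. p (exp (- ?d (w i) y))"
  have q01: "0 \<le> p (exp (- ?d v y))" "p (exp (- ?d v y)) \<le> 1" for v y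
    using p01[of "exp (- ?d v y)"] by auto
  have f01: "0 \<le> ?f y" "?f y \<le> 1" for y
    using q01 by (auto intro!: prod_nonneg prod_le_1)
  have meas: "?f \<in> borel_measurable (mm_measure W)"
  proof (rule borel_measurable_prod)
    fix i assume "i \<in> I"
    note [measurable] = mdist_measurable[OF W w[OF this]]
    show "(\<lambda>y. p (exp (- ?d (w i) y))) \<in> borel_measurable (mm_measure W)" by measurable
  qed
  have int: "integrable (mm_measure W) ?f"
    using f01 meas by (intro integrable_const_bound[where B = 1] AE_I2) auto
  show "0 \<le> cutoff_mean W p I w" unfolding cutoff_mean_def
    using f01 by (intro integral_nonneg_AE AE_I2) auto
  show "cutoff_mean W p I w \<le> 1" unfolding cutoff_mean_def
    using f01 int by (intro integral_le_const AE_I2) auto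
  have bs: "ball_union W I w r \<in> sets (mm_measure W)" for r
    using w by (intro ball_union_sets W I)
  have mi: "measure (mm_measure W) (ball_union W I w r) =
      (\<integral>y. indicator (ball_union W I w r) y \<partial>mm_measure W)" for r
    using bs by simp
  have ii: "integrable (mm_measure W) (indicator (ball_union W I w r) :: _ \<Rightarrow> real)" for r
    using emeasure_finite by (intro integrable_real_indicator bs) (metis less_top infinity_ennreal_def)
  have "cutoff_mean W p I w \<le> (\<integral>y. 1 + \<eta> - indicator (ball_union W I w \<delta>) y \<partial>mm_measure W)"
    unfolding cutoff_mean_def
  proof (rule integral_mono[OF int])
    show "integrable (mm_measure W) (\<lambda>y. 1 + \<eta> - indicator (ball_union W I w \<delta>) y)" using ii by simp
    fix y assume "y \<in> space (mm_measure W)"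
    show "?f y \<le> 1 + \<eta> - indicator (ball_union W I w \<delta>) y"
    proof (cases "y \<in> ball_union W I w \<delta>")
      case True
      then obtain i where i: "i \<in> I" "?d (w i) y < \<delta>" by (auto simp: ball_union_def)
      have "?f y = p (exp (- ?d (w i) y)) * (\<Prod>i\<in>I - {i}. p (exp (- ?d (w i) y)))"
        using I i by (intro prod.remove) auto
      also have "\<dots> \<le> p (exp (- ?d (w i) y)) * 1"
        using q01 by (intro mult_left_mono prod_le_1) auto
      also have "\<dots> \<le> \<eta>" using p0[of "exp (- ?d (w i) y)"] i by simp
      finally show ?thesis using True by simp
    next
      case False
      then show ?thesis using f01(2)[of y] \<eta> by simp
    qed
  qed
  also have "\<dots> = 1 + \<eta> - measure (mm_measure W) (ball_union W I w \<delta>)"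
    unfolding mi using ii by (simp add: prob_space)
  finally show "measure (mm_measure W) (ball_union W I w \<delta>) \<le> 1 + \<eta> - cutoff_mean W p I w" by simp
  have "1 - card I * \<eta> - measure (mm_measure W) (ball_union W I w (2 * \<delta>)) =
      (\<integral>y. 1 - card I * \<eta> - indicator (ball_union W I w (2 * \<delta>)) y \<partial>mm_measure W)"
    unfolding mi using ii by (simp add: prob_space)
  also have "\<dots> \<le> cutoff_mean W p I w"
    unfolding cutoff_mean_def
  proof (rule integral_mono[OF _ int])
    show "integrable (mm_measure W) (\<lambda>y. 1 - card I * \<eta> - indicator (ball_union W I w (2 * \<delta>)) y)"
      using ii by simp
    fix y assume y: "y \<in> space (mm_measure W)"
    show "1 - card I * \<eta> - indicator (ball_union W I w (2 * \<delta>)) y \<le> ?f y"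
    proof (cases "y \<in> ball_union W I w (2 * \<delta>)")
      case True
      have "0 \<le> card I * \<eta>" using \<eta> by simp
      then show ?thesis using True f01(1)[of y] by simp
    next
      case False
      then have "2 * \<delta> \<le> ?d (w i) y" if "i \<in> I" for i
        using that y by (auto simp: ball_union_def mm_space_space[OF W] not_less)
      then have "1 - \<eta> \<le> p (exp (- ?d (w i) y))" if "i \<in> I" for i using that by (intro p1) auto
      then have "(\<Prod>i\<in>I. 1 - \<eta>) \<le> ?f y" using \<eta> by (intro prod_mono) auto
      moreover have "1 + card I * (- \<eta>) \<le> (1 + (- \<eta>)) ^ card I"
        using \<eta> by (intro Bernoulli_inequality) auto
      ultimately show ?thesis using False by simp
    qed
  qed
  finally show "1 - card I * \<eta> - cutoff_mean W p I w \<le>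
      measure (mm_measure W) (ball_union W I w (2 * \<delta>))" by simp
qed

section \<open>Convergence from the test functions\<close>

context chi_convergent
begin

text \<open>The mean in expanded form, for \<open>p u = \<Sum>\<^sub>k c\<^sub>k u\<^sup>k\<close>. Expanding under the integral sign is legitimate only for
  points of the space, whereas being a multiplier concerns the functions everywhere; so the
  multiplier property is stated for the expansion.\<close>

definition cutoff_expansion ::
  "'c mm \<Rightarrow> (nat \<Rightarrow> real) \<Rightarrow> nat \<Rightarrow> nat set \<Rightarrow> (nat \<Rightarrow> 'c) \<Rightarrow> real" where
  "cutoff_expansion W c d I w = (\<Sum>\<kappa>\<in>I \<rightarrow>\<^sub>E {..d}.
     (\<Prod>i\<in>I. c (\<kappa> i)) * monomial_mean W (\<lambda>i. if i \<in> I then real (\<kappa> i) else 0) w)"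

lemma cutoff_mean_eq_expansion:
  assumes W: "mm_space W" and w: "w \<in> {1..K} \<rightarrow> mspace (mm_metric W)" and I: "I \<subseteq> {1..K}"
  shows "cutoff_mean W (\<lambda>u. \<Sum>k\<le>d. c k * u ^ k) I w = cutoff_expansion W c d I w"
proof -
  interpret prob_space "mm_measure W" by (rule mm_space_prob[OF W])
  let ?d = "mdist (mm_metric W)"
  let ?\<alpha> = "\<lambda>\<kappa> i. if i \<in> I then real (\<kappa> i) else 0"
  have fin: "finite I" using I finite_subset by blast
  have expand: "(\<Prod>i\<in>I. \<Sum>k\<le>d. c k * exp (- ?d (w i) y) ^ k) =
      (\<Sum>\<kappa>\<in>I \<rightarrow>\<^sub>E {..d}. (\<Prod>i\<in>I. c (\<kappa> i)) * exp (- (\<Sum>i\<in>{1..K}. ?\<alpha> \<kappa> i * ?d (w i) y)))" for y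
  proof -
    have "(\<Prod>i\<in>I. \<Sum>k\<le>d. c k * exp (- ?d (w i) y) ^ k) =
        (\<Sum>\<kappa>\<in>I \<rightarrow>\<^sub>E {..d}. \<Prod>i\<in>I. c (\<kappa> i) * exp (- ?d (w i) y) ^ \<kappa> i)"
      using fin by (intro prod_sum_PiE) auto
    also have "\<dots> = (\<Sum>\<kappa>\<in>I \<rightarrow>\<^sub>E {..d}. (\<Prod>i\<in>I. c (\<kappa> i)) *
        exp (- (\<Sum>i\<in>{1..K}. ?\<alpha> \<kappa> i * ?d (w i) y)))"
    proof (intro sum.cong refl)
      fix \<kappa> assume "\<kappa> \<in> I \<rightarrow>\<^sub>E {..d}"
      have "(\<Sum>i\<in>{1..K}. ?\<alpha> \<kappa> i * ?d (w i) y) = (\<Sum>i\<in>I. \<kappa> i * ?d (w i) y)"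
        using I by (intro sum.mono_neutral_cong_right) auto
      then have "exp (- (\<Sum>i\<in>{1..K}. ?\<alpha> \<kappa> i * ?d (w i) y)) = (\<Prod>i\<in>I. exp (- ?d (w i) y) ^ \<kappa> i)"
        using fin by (simp add: exp_sum flip: sum_negf exp_of_nat_mult)
      then show "(\<Prod>i\<in>I. c (\<kappa> i) * exp (- ?d (w i) y) ^ \<kappa> i) =
          (\<Prod>i\<in>I. c (\<kappa> i)) * exp (- (\<Sum>i\<in>{1..K}. ?\<alpha> \<kappa> i * ?d (w i) y))"
        by (simp only: prod.distrib)
    qed
    finally show ?thesis .
  qed
  have int: "integrable (mm_measure W) (\<lambda>y. exp (- (\<Sum>i\<in>{1..K}. ?\<alpha> \<kappa> i * ?d (w i) y)))" for \<kappa>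
  proof (rule integrable_const_bound[where B = 1])
    have "(\<lambda>y. \<Sum>i\<in>{1..K}. ?\<alpha> \<kappa> i * ?d (w i) y) \<in> borel_measurable (mm_measure W)"
      using w by (intro borel_measurable_sum borel_measurable_times borel_measurable_const
        mdist_measurable[OF W]) auto
    then show "(\<lambda>y. exp (- (\<Sum>i\<in>{1..K}. ?\<alpha> \<kappa> i * ?d (w i) y))) \<in> borel_measurable (mm_measure W)"
      by measurable
  qed (auto intro!: AE_I2 sum_nonneg)
  show ?thesis
    unfolding cutoff_mean_def cutoff_expansion_def monomial_mean_def expand
    using int by (subst Bochner_Integration.integral_sum) auto
qed

lemma multiplier_cutoff_expansion:
  assumes "I \<subseteq> {1..K}"
  shows "multiplier (\<lambda>n. cutoff_expansion (X n) c d I) (cutoff_expansion Y c d I)"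
proof -
  have "finite I" using assms finite_subset by blast
  then show ?thesis
    unfolding cutoff_expansion_def[abs_def]
    by (intro multiplier_sum multiplier_mult multiplier_const multiplier_monomial_mean
        finite_PiE) auto
qed

text \<open>The numbers to be realised are the \<open>exp (- r (x\<^sub>i, x\<^sub>j))\<close> for pairs of indices and the cutoff means for sets
  of indices, collected in a sum type. Up to small errors, \<open>1\<close> minus a cutoff mean bounds the mass of a union of
  \<open>\<delta>\<close>-balls in \<open>Y\<close> from above and that of a union of \<open>2 \<delta>\<close>-balls in \<open>X\<^sub>n\<close> from below, which is what the gluing
  requires.\<close>

lemma eventually_gromov_prohorov_le:
  assumes \<delta>: "0 < \<delta>" "\<delta> < 1" and K: "1 \<le> K"
    and y: "y \<in> {1..K} \<rightarrow> mspace dY"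
    and cover: "1 - \<delta> < measure (mm_measure Y) (ball_union Y {1..K} y \<delta>)"
  shows "\<forall>\<^sub>F n in sequentially. gromov_prohorov (X n) Y \<le> 4 * \<delta>"
proof -
  (* \<eta> is lost at radius \<delta>, and at most K times \<eta> at radius 2 * \<delta> *)
  define \<eta> where "\<eta> = \<delta> / (2 * (K + 1))"
  have \<eta>: "0 < \<eta>" "\<eta> < 1 / 2" "(K + 1) * \<eta> = \<delta> / 2"
    using \<delta> K by (auto simp: \<eta>_def field_simps)
  have thresholds: "0 < exp (- (2 * \<delta>))" "exp (- (2 * \<delta>)) < exp (- \<delta>)" "exp (- \<delta>) < 1"
    using \<delta> by auto
  obtain d :: nat and c :: "nat \<Rightarrow> real" where
    p01: "\<And>u. 0 \<le> u \<Longrightarrow> u \<le> 1 \<Longrightarrow> 0 \<le> (\<Sum>k\<le>d. c k * u ^ k) \<and> (\<Sum>k\<le>d. c k * u ^ k) \<le> 1"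
    and p1: "\<And>u. 0 \<le> u \<Longrightarrow> u \<le> exp (- (2 * \<delta>)) \<Longrightarrow> 1 - \<eta> \<le> (\<Sum>k\<le>d. c k * u ^ k)"
    and p0: "\<And>u. exp (- \<delta>) \<le> u \<Longrightarrow> u \<le> 1 \<Longrightarrow> (\<Sum>k\<le>d. c k * u ^ k) \<le> \<eta>"
    by (rule polynomial_cutoff[OF thresholds \<eta>(1,2)]) (use that in blast)
  define p where "p = (\<lambda>u. \<Sum>k\<le>d. c k * u ^ k)"
  have pm: "p \<in> borel_measurable borel" unfolding p_def by measurable
  have p: "\<And>u. 0 \<le> u \<Longrightarrow> u \<le> 1 \<Longrightarrow> 0 \<le> p u \<and> p u \<le> 1"
    "\<And>u. 0 \<le> u \<Longrightarrow> u \<le> exp (- (2 * \<delta>)) \<Longrightarrow> 1 - \<eta> \<le> p u"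
    "\<And>u. exp (- \<delta>) \<le> u \<Longrightarrow> u \<le> 1 \<Longrightarrow> p u \<le> \<eta>"
    unfolding p_def by (fact p01 p1 p0)+
  have bounds: "0 \<le> cutoff_mean W p I w" "cutoff_mean W p I w \<le> 1"
    "measure (mm_measure W) (ball_union W I w \<delta>) \<le> 1 + \<eta> - cutoff_mean W p I w"
    "1 - card I * \<eta> - cutoff_mean W p I w \<le> measure (mm_measure W) (ball_union W I w (2 * \<delta>))"
    if "mm_space W" "finite I" "\<And>i. i \<in> I \<Longrightarrow> w i \<in> mspace (mm_metric W)"
    for W :: "'w mm" and I :: "nat set" and w
    by (rule cutoff_mean_bounds[where \<delta> = \<delta> and \<eta> = \<eta>];
        use that pm p \<eta>(1,2) in \<open>force simp: less_imp_le\<close>)+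
  define R where "R = (\<Sum>(i, j)\<in>index_pairs K. mdist dY (y i) (y j))"
  define e where "e = min (\<delta> / 2) (exp (- R) * (1 - exp (- (2 * \<delta>))))"
  have e: "0 < e" "e < 1" "e \<le> \<delta> / 2" "e \<le> exp (- R) * (1 - exp (- (2 * \<delta>)))"
    using \<delta> by (auto simp: e_def min_less_iff_disj)
  define D where "D = index_pairs K <+> Pow {1..K}"
  define P where "P = (\<lambda>d' n x. case d' of Inl (i, j) \<Rightarrow> exp (- mdist (dX n) (x i) (x j))
    | Inr I \<Rightarrow> cutoff_expansion (X n) c d I x)"
  define Q where "Q = (\<lambda>d' x. case d' of Inl (i, j) \<Rightarrow> exp (- mdist dY (x i) (x j))
    | Inr I \<Rightarrow> cutoff_expansion Y c d I x)"
  have "\<forall>\<^sub>F n in sequentially. \<exists>x \<in> {1..K} \<rightarrow> mspace (dX n). \<forall>d'\<in>D. \<bar>P d' n x - Q d' y\<bar> < e"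
  proof (rule eventually_realised)
    show "finite D" unfolding D_def by (intro finite_Plus finite_index_pairs) auto
    show "multiplier (P d') (Q d')" if "d' \<in> D" for d'
      using that multiplier_exp_dist multiplier_cutoff_expansion
      by (auto simp: D_def P_def Q_def)
    have cut01: "0 \<le> cutoff_expansion W c d I x \<and> cutoff_expansion W c d I x \<le> 1"
      if "mm_space W" "I \<subseteq> {1..K}" "x \<in> {1..K} \<rightarrow> mspace (mm_metric W)" for W :: "'w mm" and I x
    proof -
      have I: "finite I" using that finite_subset by blast
      have x: "x i \<in> mspace (mm_metric W)" if "i \<in> I" for i
        using that \<open>I \<subseteq> {1..K}\<close> \<open>x \<in> _\<close> by blast
      have eq: "cutoff_mean W p I x = cutoff_expansion W c d I x"
        unfolding p_def using that by (intro cutoff_mean_eq_expansion)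
      show ?thesis
        unfolding eq[symmetric] by (intro conjI bounds(1,2) \<open>mm_space W\<close> I x)
    qed
    show "0 \<le> P d' n x \<and> P d' n x \<le> 1"
      if "d' \<in> D" "x \<in> {1..K} \<rightarrow> mspace (dX n)" for d' n x
      using that cut01[OF X] by (auto simp: D_def P_def)
    show "0 \<le> Q d' x \<and> Q d' x \<le> 1" if "d' \<in> D" "x \<in> {1..K} \<rightarrow> mspace dY" for d' x
      using that cut01[OF Y] by (auto simp: D_def Q_def)
  qed (use y e in auto)
  then show ?thesis
  proof (rule eventually_mono)
    fix n assume "\<exists>x \<in> {1..K} \<rightarrow> mspace (dX n). \<forall>d'\<in>D. \<bar>P d' n x - Q d' y\<bar> < e"
    then obtain x where x: "x \<in> {1..K} \<rightarrow> mspace (dX n)"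
      and close: "\<And>d'. d' \<in> D \<Longrightarrow> \<bar>P d' n x - Q d' y\<bar> < e" by blast
    have near': "\<bar>mdist (dX n) (x i) (x j) - mdist dY (y i) (y j)\<bar> \<le> 2 * \<delta>"
      if ij: "(i, j) \<in> index_pairs K" for i j
    proof (rule exp_close_imp_close)
      show "mdist dY (y i) (y j) \<le> R"
        unfolding R_def using member_le_sum[OF ij, of "\<lambda>(i, j). mdist dY (y i) (y j)"] finite_index_pairs
        by auto
      show "\<bar>exp (- mdist (dX n) (x i) (x j)) - exp (- mdist dY (y i) (y j))\<bar>
          < exp (- R) * (1 - exp (- (2 * \<delta>)))"
        using close[OF InlI[OF ij, of "Pow {1..K}", folded D_def]] e(4)
        by (simp add: P_def Q_def)
    qed (use \<delta> in simp)
    show "gromov_prohorov (X n) Y \<le> 4 * \<delta>"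
    proof (rule gromov_prohorov_le_of_nets[OF X Y, where I = "{1..K}"])
      show "\<bar>mdist (dX n) (x i) (x j) - mdist dY (y i) (y j)\<bar> \<le> 2 * \<delta>"
        if ij: "i \<in> {1..K}" "j \<in> {1..K}" for i j
      proof (cases i j rule: linorder_cases)
        case less
        then show ?thesis using near'[of i j] ij by (simp add: index_pairs_def)
      next
        case equal
        have "x i \<in> mspace (dX n)" "y i \<in> mspace dY" using x y ij by blast+
        then have "mdist (dX n) (x i) (x i) = 0" "mdist dY (y i) (y i) = 0" by simp_all
        then show ?thesis unfolding equal[symmetric] using \<delta> by linarith
      next
        case greater
        then show ?thesis using near'[of j i] ij by (simp add: index_pairs_def mdist_commute)
      qed
      fix J assume J: "J \<subseteq> {1..K}"
      then have finJ: "finite J" "card J \<le> K"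
        using finite_subset card_mono[of "{1..K}" J] by auto
      have xJ: "x i \<in> mspace (dX n)" and yJ: "y i \<in> mspace dY" if "i \<in> J" for i
        using that J x y by auto
      have "\<bar>cutoff_mean (X n) p J x - cutoff_mean Y p J y\<bar> < e"
        unfolding p_def cutoff_mean_eq_expansion[OF X x J] cutoff_mean_eq_expansion[OF Y y J]
        using close[OF InrI[OF PowI[OF J], of "index_pairs K", folded D_def]]
        by (simp add: P_def Q_def)
      moreover have "measure (mm_measure Y) (ball_union Y J y \<delta>) \<le> 1 + \<eta> - cutoff_mean Y p J y"
        using \<eta> by (intro bounds(3) Y finJ yJ) auto
      moreover have "1 - card J * \<eta> - cutoff_mean (X n) p J x \<le>
          measure (mm_measure (X n)) (ball_union (X n) J x (2 * \<delta>))"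
        using \<eta> by (intro bounds(4) X finJ xJ) auto
      moreover have "card J * \<eta> + \<eta> \<le> \<delta> / 2"
      proof -
        have "card J * \<eta> + \<eta> \<le> K * \<eta> + \<eta>" using finJ \<eta> by simp
        also have "\<dots> = \<delta> / 2" using \<eta>(3) by (simp add: algebra_simps)
        finally show ?thesis .
      qed
      ultimately show "measure (mm_measure Y) (ball_union Y J y \<delta>) \<le>
          measure (mm_measure (X n)) (ball_union (X n) J x (2 * \<delta>)) + \<delta>"
        using e(3) by linarith
    qed (use x y \<delta> K cover in auto)
  qed
qed

end

lemma chi_imp_gromov_prohorov:
  fixes X :: "nat \<Rightarrow> 'a mm" and Y :: "'b mm"
  assumes X: "\<And>n. mm_space (X n)" and Y: "mm_space Y"
    and chi: "\<And>A. A \<in> arrays \<Longrightarrow> (\<lambda>n. chi A (X n)) \<longlonglongrightarrow> chi A Y"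
  shows "(\<lambda>n. gromov_prohorov (X n) Y) \<longlonglongrightarrow> 0"
proof (rule tendstoI)
  fix \<epsilon> :: real assume \<epsilon>: "0 < \<epsilon>"
  define \<delta> where "\<delta> = min (1 / 2) (\<epsilon> / 5)"
  have \<delta>: "0 < \<delta>" "\<delta> < 1" "4 * \<delta> < \<epsilon>" using \<epsilon> by (auto simp: \<delta>_def)
  obtain K :: nat and y where K: "1 \<le> K" and y: "y \<in> {1..K} \<rightarrow> mspace (mm_metric Y)"
    "1 - \<delta> < measure (mm_measure Y) (ball_union Y {1..K} y \<delta>)"
    by (rule mm_space_finite_net[OF Y \<delta>(1)]) (use that in blast)
  interpret chi_convergent X Y K by unfold_locales (fact X Y chi)+
  show "\<forall>\<^sub>F n in sequentially. dist (gromov_prohorov (X n) Y) 0 < \<epsilon>"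
    using eventually_gromov_prohorov_le[OF \<delta>(1,2) K y]
  proof (rule eventually_mono)
    fix n assume "gromov_prohorov (X n) Y \<le> 4 * \<delta>"
    then show "dist (gromov_prohorov (X n) Y) 0 < \<epsilon>"
      using gromov_prohorov_nonneg[OF X[of n] Y] \<delta>(3) by (simp add: dist_real_def)
  qed
qed

theorem lemma3p5:
  fixes X :: "nat \<Rightarrow> 'a mm" and Y :: "'b mm"
  assumes "\<And>n. mm_space (X n)" and "mm_space Y"
  shows "(\<lambda>n. gromov_prohorov (X n) Y) \<longlonglongrightarrow> 0 \<longleftrightarrow>
         (\<forall>A\<in>arrays. (\<lambda>n. chi A (X n)) \<longlonglongrightarrow> chi A Y)"
proof (intro iffI ballI)
  fix A :: array assume "(\<lambda>n. gromov_prohorov (X n) Y) \<longlonglongrightarrow> 0" "A \<in> arrays"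
  then show "(\<lambda>n. chi A (X n)) \<longlonglongrightarrow> chi A Y" using assms by (intro gromov_prohorov_imp_chi)
next
  assume "\<forall>A\<in>arrays. (\<lambda>n. chi A (X n)) \<longlonglongrightarrow> chi A Y"
  then show "(\<lambda>n. gromov_prohorov (X n) Y) \<longlonglongrightarrow> 0" using assms by (intro chi_imp_gromov_prohorov) auto
qed

end
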